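(* Let $\mathbb{A}$ be a finite dimensional nontrivial associative real $^*$-algebra with unit, with $\mathbb{S}_{\mathbb{A}}\ne\varnothing$ and with a complete submultiplicative norm $|\cdot|$ such that $|q|^2=qq^c$ for all $q\in Q_{\mathbb{A}}$, and let $X$ be a Banach two-sided $\mathbb{A}$-module. Let $\mathsf{T}:[0,\infty)\to\mathscr{L}^r(X)$ be a strongly continuous right linear semigroup, let $\mathsf{A}:D(\mathsf{A})\to X$ be its generator, and let $\omega\in\mathbb{R}$ be such that $M:=\sup_{t\in[0,\infty)}\|\mathsf{T}(t)\|e^{-\omega t}<\infty$. Let $q\in Q_{\mathbb{A}}$, set $a:=\mathrm{Re}(q)$ and $b:=|\mathrm{Im}(q)|$, and let $g_q(t):=te^{-at}\,\mathrm{sinc}(tb)$ for $t\in\mathbb{R}$. If $\mathrm{Re}(q)>\omega$, then $q\in\rho_{S}(\mathsf{A})$ and, for every $x\in X$, $$\mathsf{Q}_q(\mathsf{A})x=\int_0^\infty\mathsf{T}(t)g_q(t)x\,dt=\int_0^\infty\mathsf{T}(t)te^{-ta}\,\mathrm{sinc}(tb)x\,dt,$$ $$\mathsf{A}\mathsf{Q}_q(\mathsf{A})x=-\int_0^\infty\mathsf{T}(t)g_q'(t)x\,dt=-\int_0^\infty\mathsf{T}(t)e^{-ta}\big(\cos(tb)-at\,\mathrm{sinc}(tb)\big)x\,dt,$$ $$\mathsf{C}_q(\mathsf{A})x=\int_0^\infty\mathsf{T}(t)e^{-tq}x\,dt.$$ Moreover $$\|\mathsf{Q}_q(\mathsf{A})\|\le\frac{M}{(\mathrm{Re}(q)-\omega)^2},\qquad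 \|\mathsf{C}_q(\mathsf{A})\|\le\frac{M}{\mathrm{Re}(q)-\omega}.$$
   Context: A real $^*$-algebra $\mathbb{A}$ is a real algebra with unit $1$ together with an $\mathbb{R}$-linear map $q\mapsto q^c$ such that $(q^c)^c=q$, $(pq)^c=q^cp^c$ and $r^c=r$ for $r\in\mathbb{R}$, where $\mathbb{R}$ is identified with $\mathbb{R}1$. Put $\mathbb{S}_{\mathbb{A}}:=\{q\in\mathbb{A}: q^c=-q,\ q^2=-1\}$, $\mathbb{C}_{\mathbf{j}}:=\{r+s\mathbf{j}: r,s\in\mathbb{R}\}$ for $\mathbf{j}\in\mathbb{S}_{\mathbb{A}}$, and $Q_{\mathbb{A}}:=\bigcup_{\mathbf{j}\in\mathbb{S}_{\mathbb{A}}}\mathbb{C}_{\mathbf{j}}$ (quadratic cone); $qq^c\in\mathbb{R}$ for $q\in Q_{\mathbb{A}}$. Submultiplicative means $|q_1q_2|\le|q_1||q_2|$ for all $q_1,q_2\in\mathbb{A}$. $\mathrm{Re}(q):=(q+q^c)/2$, $\mathrm{Im}(q):=(q-q^c)/2$; for $q\in Q_{\mathbb{A}}$, $\mathrm{Re}(q)\in\mathbb{R}$. $e^{-tq}:=\sum_{k\ge0}(-tq)^k/k!$. $\mathrm{sinc}:\mathbb{R}\to\mathbb{R}$ is $\mathrm{sinc}(0)=1$, $\mathrm{sinc}(r)=\sin(r)/r$ for $r\ne0$. A two-sided $\mathbb{A}$-module $X$ is a commutative group $(X,+)$ with left and right scalar multiplications by $\mathbb{A}$, each distributive in both arguments, with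 $1x=x=x1$, $p(qx)=(pq)x$, $(xp)q=x(pq)$, $p(xq)=(px)q$ for $p,q\in\mathbb{A}$, and $rx=xr$ for $r\in\mathbb{R}$. It is a Banach two-sided $\mathbb{A}$-module if it has a function $\|\cdot\|:X\to[0,\infty)$ with $\|x\|=0\iff x=0$, $\|x+y\|\le\|x\|+\|y\|$, $\|qx\|\le|q|\|x\|$, $\|xq\|\le|q|\|x\|$, and the metric $\|x-y\|$ is complete. In particular $X$ is a real Banach space, and $X$-valued integrals are Lebesgue (Bochner) integrals in it. A right linear operator is an additive map $\mathsf{A}:D(\mathsf{A})\to X$, where $D(\mathsf{A})\subseteq X$ is a right $\mathbb{A}$-submodule (an additive subgroup closed under right multiplication by $\mathbb{A}$), with $\mathsf{A}(xq)=\mathsf{A}(x)q$. $\mathscr{L}^r(X)$ is the set of right linear $\mathsf{B}:X\to X$ with $\|\mathsf{B}\|:=\sup_{x\ne0}\|\mathsf{B}x\|/\|x\|<\infty$. For $\mathsf{B}$ right linear on $X$ and $p\in\mathbb{A}$, $\mathsf{B}p$ is the operator $(\mathsf{B}p)(x):=\mathsf{B}(px)$. $D(\mathsf{A}^2)=\{x\in D(\mathsf{A}):\mathsf{A}x\in D(\mathsf{A})\}$. A strongly continuous right linear semigroup is a map $\mathsf{T}:[0,\infty)\to\mathscr{L}^r(X)$ such that $t\mapsto\mathsf{T}(t)x$ is continuous for every $x\in X$, $\mathsf{T}(t+s)=\mathsf{T}(t)\mathsf{T}(s)$ for $t,s>0$, and $\mathsf{T}(0)=\mathrm{Id}$. Its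 generator is $\mathsf{A}x:=\lim_{h\to0^+}\frac1h(\mathsf{T}(h)x-x)$, with $D(\mathsf{A})$ the set of $x\in X$ for which this limit exists in $X$. For a closed right linear operator $\mathsf{A}$ (generators are closed) and $q\in Q_{\mathbb{A}}$: $\Delta_q(\mathsf{A}):=\mathsf{A}^2-2\mathrm{Re}(q)\mathsf{A}+|q|^2\mathrm{Id}:D(\mathsf{A}^2)\to X$. The spherical resolvent set is $\rho_{S}(\mathsf{A}):=\{q\in Q_{\mathbb{A}}:\Delta_q(\mathsf{A})\text{ is bijective and }\Delta_q(\mathsf{A})^{-1}\in\mathscr{L}^r(X)\}$. For $q\in\rho_S(\mathsf{A})$, $\mathsf{Q}_q(\mathsf{A}):=\Delta_q(\mathsf{A})^{-1}$ (spherical quasi-resolvent operator) and $\mathsf{C}_q(\mathsf{A}):=\mathsf{Q}_q(\mathsf{A})q^c-\mathsf{A}\mathsf{Q}_q(\mathsf{A})$ (spherical resolvent operator). *)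

theory Defs
  imports "HOL-Analysis.Analysis" "HOL-Probability.Sinc_Integral"
begin

section \<open>Real *-algebras and the quadratic cone\<close>

class real_star_algebra = real_algebra_1 +
  fixes star :: "'a \<Rightarrow> 'a"
  assumes star_add: "star (p + q) = star p + star q"
    and star_scaleR: "star (r *\<^sub>R q) = r *\<^sub>R star q"
    and star_star: "star (star q) = q"
    and star_mult: "star (p * q) = star q * star p"
    and star_real: "star (r *\<^sub>R 1) = r *\<^sub>R 1"

definition imag_sphere :: "'a::real_star_algebra set" where
  "imag_sphere = {q. star q = - q \<and> q\<^sup>2 = - 1}"

definition slice :: "'a::real_star_algebra \<Rightarrow> 'a set" where
  "slice j = {of_real r + s *\<^sub>R j | r s. True}"

definition quadratic_cone :: "'a::real_star_algebra set" where
  "quadratic_cone = (\<Union>j\<in>imag_sphere. slice j)"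

definition Re_part :: "'a::real_star_algebra \<Rightarrow> 'a" where
  "Re_part q = (q + star q) /\<^sub>R 2"

definition Im_part :: "'a::real_star_algebra \<Rightarrow> 'a" where
  "Im_part q = (q - star q) /\<^sub>R 2"

text \<open>\<open>Re_part q\<close> as a real number; meaningful when \<open>Re_part q\<close> lies in \<open>\<real>\<close>, in particular
  on the quadratic cone (lemma \<open>of_real_re\<close>).\<close>

definition re :: "'a::real_star_algebra \<Rightarrow> real" where
  "re q = (THE r. of_real r = Re_part q)"

lemma of_real_re:
  assumes "q \<in> quadratic_cone"
  shows "of_real (re q) = Re_part q"
proof -
  from assms obtain j r s where j: "star j = - j" and q: "q = of_real r + s *\<^sub>R j"
    by (auto simp: quadratic_cone_def slice_def imag_sphere_def)
  have "star q = of_real r - s *\<^sub>R j"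
    using j star_real[of r] by (simp add: q star_add star_scaleR of_real_def)
  then have "Re_part q = of_real r"
    by (simp add: Re_part_def q of_real_def flip: scaleR_add_left)
  then show ?thesis
    by (simp add: re_def)
qed

section \<open>Banach two-sided modules\<close>

text \<open>The real Banach space structure that the module carries via \<open>\<real> \<subseteq> \<bbbA>\<close> is the one of the
  type \<open>'x\<close>; \<open>lmul_real\<close> and \<open>rmul_real\<close> identify the two (and contain \<open>r x = x r\<close> for real \<open>r\<close>).\<close>

locale banach_two_sided_module =
  fixes lmul :: "'a::real_normed_algebra_1 \<Rightarrow> 'x::banach \<Rightarrow> 'x"
    and rmul :: "'x \<Rightarrow> 'a \<Rightarrow> 'x"
  assumes lmul_add_left: "lmul (p + q) x = lmul p x + lmul q x"
    and lmul_add_right: "lmul q (x + y) = lmul q x + lmul q y"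
    and rmul_add_left: "rmul (x + y) q = rmul x q + rmul y q"
    and rmul_add_right: "rmul x (p + q) = rmul x p + rmul x q"
    and lmul_one: "lmul 1 x = x"
    and rmul_one: "rmul x 1 = x"
    and lmul_lmul: "lmul p (lmul q x) = lmul (p * q) x"
    and rmul_rmul: "rmul (rmul x p) q = rmul x (p * q)"
    and lmul_rmul: "lmul p (rmul x q) = rmul (lmul p x) q"
    and lmul_real: "lmul (of_real r) x = r *\<^sub>R x"
    and rmul_real: "rmul x (of_real r) = r *\<^sub>R x"
    and norm_lmul: "norm (lmul q x) \<le> norm q * norm x"
    and norm_rmul: "norm (rmul x q) \<le> norm q * norm x"

section \<open>Right linear operators, semigroups, spherical resolvent\<close>

text \<open>\<open>bounded_right_linear rmul B\<close> says that \<open>B\<close> belongs to $\mathscr{L}^r(X)$. Its norm is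
  \<^term>\<open>onorm B\<close>, the supremum of the quotients \<^term>\<open>norm (B x) / norm x\<close>, where \<^term>\<open>x = 0\<close>
  contributes \<open>0\<close>.\<close>

definition bounded_right_linear ::
    "('x::real_normed_vector \<Rightarrow> 'a \<Rightarrow> 'x) \<Rightarrow> ('x \<Rightarrow> 'x) \<Rightarrow> bool" where
  "bounded_right_linear rmul B \<longleftrightarrow>
     (\<forall>x y. B (x + y) = B x + B y) \<and>
     (\<forall>x q. B (rmul x q) = rmul (B x) q) \<and>
     bdd_above ((\<lambda>x. norm (B x) / norm x) ` {x. x \<noteq> 0})"

definition right_linear_semigroup ::
    "('x::real_normed_vector \<Rightarrow> 'a \<Rightarrow> 'x) \<Rightarrow> (real \<Rightarrow> 'x \<Rightarrow> 'x) \<Rightarrow> bool" where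
  "right_linear_semigroup rmul T \<longleftrightarrow>
     (\<forall>t\<ge>0. bounded_right_linear rmul (T t)) \<and>
     (\<forall>x. continuous_on {0..} (\<lambda>t. T t x)) \<and>
     (\<forall>t>0. \<forall>s>0. T (t + s) = T t \<circ> T s) \<and>
     T 0 = id"

text \<open>A partially defined operator is given by its domain \<open>D\<close> and a function \<open>A\<close> of which only the
  values on \<open>D\<close> matter.\<close>

definition is_generator ::
    "(real \<Rightarrow> 'x::real_normed_vector \<Rightarrow> 'x) \<Rightarrow> 'x set \<Rightarrow> ('x \<Rightarrow> 'x) \<Rightarrow> bool" where
  "is_generator T D A \<longleftrightarrow>
     D = {x. \<exists>y. ((\<lambda>h. (T h x - x) /\<^sub>R h) \<longlongrightarrow> y) (at_right 0)} \<and>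
     (\<forall>x\<in>D. ((\<lambda>h. (T h x - x) /\<^sub>R h) \<longlongrightarrow> A x) (at_right 0))"

definition domain_square :: "'x set \<Rightarrow> ('x \<Rightarrow> 'x) \<Rightarrow> 'x set" where
  "domain_square D A = {x \<in> D. A x \<in> D}"

definition Delta_op ::
    "('x::real_normed_vector \<Rightarrow> 'x) \<Rightarrow> 'a::{real_star_algebra, real_normed_algebra_1} \<Rightarrow> 'x \<Rightarrow> 'x" where
  "Delta_op A q x = A (A x) - (2 * re q) *\<^sub>R A x + (norm q)\<^sup>2 *\<^sub>R x"

definition quasi_resolvent ::
    "'x::real_normed_vector set \<Rightarrow> ('x \<Rightarrow> 'x) \<Rightarrow> 'a::{real_star_algebra, real_normed_algebra_1}
      \<Rightarrow> 'x \<Rightarrow> 'x" where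
  "quasi_resolvent D A q = inv_into (domain_square D A) (Delta_op A q)"

definition spherical_resolvent_set ::
    "('x::real_normed_vector \<Rightarrow> 'a::{real_star_algebra, real_normed_algebra_1} \<Rightarrow> 'x)
      \<Rightarrow> 'x set \<Rightarrow> ('x \<Rightarrow> 'x) \<Rightarrow> 'a set" where
  "spherical_resolvent_set rmul D A =
     {q \<in> quadratic_cone. bij_betw (Delta_op A q) (domain_square D A) UNIV \<and>
        bounded_right_linear rmul (quasi_resolvent D A q)}"

text \<open>For an operator \<open>B\<close> and a scalar \<open>p\<close>, the operator \<open>B p\<close> maps \<open>x\<close> to \<open>B (p x)\<close>.\<close>

definition spherical_resolvent ::
    "('a::{real_star_algebra, real_normed_algebra_1} \<Rightarrow> 'x::real_normed_vector \<Rightarrow> 'x)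
      \<Rightarrow> 'x set \<Rightarrow> ('x \<Rightarrow> 'x) \<Rightarrow> 'a \<Rightarrow> 'x \<Rightarrow> 'x" where
  "spherical_resolvent lmul D A q x =
     quasi_resolvent D A q (lmul (star q) x) - A (quasi_resolvent D A q x)"

section \<open>The Bochner integral without separability\<close>

text \<open>The library's \<^const>\<open>has_bochner_integral\<close> is restricted to second countable target spaces,
  whereas the module here is an arbitrary Banach space. The definition is the same, without that
  restriction; approximability by simple functions in the $L^1$ sense forces \<open>f\<close> to be almost
  everywhere separably valued.\<close>

inductive has_general_bochner_integral ::
    "'a measure \<Rightarrow> ('a \<Rightarrow> 'b::real_normed_vector) \<Rightarrow> 'b \<Rightarrow> bool" for M f y where
  "f \<in> borel_measurable M \<Longrightarrow>
   (\<And>i::nat. Bochner_Integration.simple_bochner_integrable M (s i)) \<Longrightarrow>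
   (\<lambda>i. \<integral>\<^sup>+t. norm (f t - s i t) \<partial>M) \<longlonglongrightarrow> 0 \<Longrightarrow>
   (\<lambda>i. Bochner_Integration.simple_bochner_integral M (s i)) \<longlonglongrightarrow> y \<Longrightarrow>
   has_general_bochner_integral M f y"

text \<open>\<open>f\<close> is integrable over \<open>S\<close> with integral \<open>y\<close>.\<close>

definition has_set_bochner_integral ::
    "'a measure \<Rightarrow> 'a set \<Rightarrow> ('a \<Rightarrow> 'b::real_normed_vector) \<Rightarrow> 'b \<Rightarrow> bool" where
  "has_set_bochner_integral M S f y \<longleftrightarrow>
     has_general_bochner_integral M (\<lambda>t. indicator S t *\<^sub>R f t) y"

lemma has_general_bochner_integral_iff_library:
  fixes f :: "'a \<Rightarrow> 'b::{real_normed_vector, second_countable_topology}"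
  shows "has_general_bochner_integral M f y \<longleftrightarrow> has_bochner_integral M f y"
  by (simp add: has_general_bochner_integral.simps has_bochner_integral.simps)

lemma measurable_norm_diff_simple:
  fixes f :: "'a \<Rightarrow> 'b::real_normed_vector"
  assumes f: "f \<in> borel_measurable M" and s: "Bochner_Integration.simple_bochner_integrable M s"
  shows "(\<lambda>t. norm (f t - s t)) \<in> borel_measurable M"
proof -
  have sf: "simple_function M s"
    using s by (auto elim: Bochner_Integration.simple_bochner_integrable.cases)
  have 1: "(\<lambda>t. norm (f t - c)) \<in> borel_measurable M" for c
    by (rule measurable_compose[OF f])
       (auto intro!: borel_measurable_continuous_onI continuous_intros)
  have 2: "s \<in> measurable M (count_space (s ` space M))"
    using sf by (auto simp: simple_function_def measurable_count_space_eq2 vimage_def)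
  show ?thesis
    by (rule measurable_compose_countable'[OF 1 2])
       (use sf in \<open>auto simp: simple_function_def intro: countable_finite\<close>)
qed

lemma has_general_bochner_integral_unique:
  assumes "has_general_bochner_integral M f y" "has_general_bochner_integral M f z"
  shows "y = z"
proof -
  obtain s where f: "f \<in> borel_measurable M" and s: "\<And>i. Bochner_Integration.simple_bochner_integrable M (s i)"
    and s0: "(\<lambda>i::nat. \<integral>\<^sup>+t. norm (f t - s i t) \<partial>M) \<longlonglongrightarrow> 0"
    and sy: "(\<lambda>i. Bochner_Integration.simple_bochner_integral M (s i)) \<longlonglongrightarrow> y"
    using assms(1) by (elim has_general_bochner_integral.cases) auto
  obtain r where r: "\<And>i. Bochner_Integration.simple_bochner_integrable M (r i)"
    and r0: "(\<lambda>i::nat. \<integral>\<^sup>+t. norm (f t - r i t) \<partial>M) \<longlonglongrightarrow> 0"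
    and rz: "(\<lambda>i. Bochner_Integration.simple_bochner_integral M (r i)) \<longlonglongrightarrow> z"
    using assms(2) by (elim has_general_bochner_integral.cases) auto
  let ?s = "\<lambda>i. Bochner_Integration.simple_bochner_integral M (s i)"
  let ?r = "\<lambda>i. Bochner_Integration.simple_bochner_integral M (r i)"
  let ?S = "\<lambda>i. \<integral>\<^sup>+t. norm (f t - s i t) \<partial>M"
  let ?R = "\<lambda>i. \<integral>\<^sup>+t. norm (f t - r i t) \<partial>M"
  have le: "ennreal (norm (?s i - ?r i)) \<le> ?S i + ?R i" for i
  proof -
    have "norm (?s i - ?r i) = norm (Bochner_Integration.simple_bochner_integral M (\<lambda>t. s i t - r i t))"
      using s r by (subst simple_bochner_integral_diff) auto
    also have "\<dots> \<le> Bochner_Integration.simple_bochner_integral M (\<lambda>t. norm (s i t - r i t))"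
      using simple_bochner_integrable_compose2[of "(-)" M "s i" "r i"] s r
      by (auto intro!: simple_bochner_integral_norm_bound)
    finally have "ennreal (norm (?s i - ?r i))
        \<le> ennreal (Bochner_Integration.simple_bochner_integral M (\<lambda>t. norm (s i t - r i t)))"
      by (rule ennreal_leI)
    also have "\<dots> = (\<integral>\<^sup>+t. norm (s i t - r i t) \<partial>M)"
      using simple_bochner_integrable_compose2[of "\<lambda>x y. norm (x - y)" M "s i" "r i"] s r
      by (auto intro!: simple_bochner_integral_eq_nn_integral)
    also have "\<dots> \<le> (\<integral>\<^sup>+t. ennreal (norm (f t - s i t)) + ennreal (norm (f t - r i t)) \<partial>M)"
    proof (rule nn_integral_mono)
      fix t
      have "norm (s i t - r i t) \<le> norm (f t - s i t) + norm (f t - r i t)"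
        by (metis dual_order.refl norm_diff_triangle_le norm_minus_commute)
      then show "ennreal (norm (s i t - r i t))
          \<le> ennreal (norm (f t - s i t)) + ennreal (norm (f t - r i t))"
        by (metis ennreal_leI ennreal_plus norm_ge_zero)
    qed
    also have "\<dots> = ?S i + ?R i"
      using measurable_norm_diff_simple[OF f s] measurable_norm_diff_simple[OF f r]
      by (intro nn_integral_add) auto
    finally show ?thesis .
  qed
  have "(\<lambda>i. ennreal (norm (?s i - ?r i))) \<longlonglongrightarrow> 0"
    by (rule tendsto_sandwich[OF _ _ tendsto_const])
       (use le tendsto_add[OF s0 r0] in auto)
  then have "(\<lambda>i. norm (?s i - ?r i)) \<longlonglongrightarrow> 0"
    by (simp add: ennreal_0[symmetric] del: ennreal_0)
  moreover have "(\<lambda>i. norm (?s i - ?r i)) \<longlonglongrightarrow> norm (y - z)"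
    by (intro tendsto_intros sy rz)
  ultimately show ?thesis
    using LIMSEQ_unique by fastforce
qed

end

theory Submission
  imports Defs
begin

text \<open>
  Write \<open>s\<close> for the solution of $s'' = -b^2 s$ with $s(0)=0$, $s'(0)=1$, that is
  $s(t) = t\,\mathrm{sinc}(tb)$, and let $g(t)=e^{-at}s(t)$ and $k(t)=e^{-at}\cos(tb)$. The space
  spanned by \<open>g\<close> and \<open>k\<close> is invariant under translations, by the addition theorems of sine and
  cosine. For the vectors $y=\int_0^\infty g(t)T(t)x\,dt$ and $w=\int_0^\infty k(t)T(t)x\,dt$ this
  turns the effect of \<open>T h\<close>, which translates the orbit, into a combination, with explicit
  coefficients in \<open>h\<close>, of the tails $\int_h^\infty g(t)T(t)x\,dt$ and $\int_h^\infty k(t)T(t)x\,dt$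
  (\<open>T_sine_integral\<close>, \<open>T_cosine_integral\<close>). Differentiation at \<open>h = 0\<close> uses only the product rule and
  the fundamental theorem of calculus, and gives
  $Ay = ay - w$ and $Aw = aw + b^2y - x$
  (\<open>generates_sine_integral\<close>, \<open>generates_cosine_integral\<close>). Eliminating \<open>w\<close> yields
  $(A^2 - 2aA + a^2+b^2)y = x$, so $x \mapsto y$ is a right inverse of $\Delta_q(A)$.
  Since it is bounded and commutes with the semigroup, it commutes with the generator, and hence it is
  also a left inverse. The second integral representation is the formula for \<open>Ay\<close>, because
  $g' = k - ag$.

  For the spherical resolvent, write $q = a + \sigma j$ with $j^2=-1$ and $b=|\sigma|$. Then
  $e^{-tq} = e^{-at}(\cos(t\sigma) - \sin(t\sigma)j) = g(t)q^c + g'(t)$, so that the integral of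
  $T(t)e^{-tq}x$ is the first integral for the vector $q^cx$ plus the second one for \<open>x\<close>. The norm bounds follow from
  $|\mathrm{sinc}|\le 1$ and $|e^{-tq}| = e^{-at}$, the latter because $e^{-tq}$ lies in the slice
  of \<open>j\<close>, on which the norm is Euclidean.

  Since the module may be inseparable, the calculations use the gauge integral, which makes sense in
  every Banach space. A continuous function that decays
  exponentially on the half-line is an $L^1$-limit of step functions, and therefore its gauge integral
  is also its Bochner integral (\<open>has_set_bochner_integral_exp_decay\<close>).
\<close>

section \<open>Integrals over half-lines in Banach spaces\<close>

lemma has_integral_translation:
  fixes f :: "'a::euclidean_space \<Rightarrow> 'b::real_normed_vector"
  assumes "(f has_integral I) UNIV"
  shows "((\<lambda>x. f (x + c)) has_integral I) UNIV"
proof -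
  have UNIV_not_cbox: "UNIV \<noteq> cbox a b" for a b :: 'a
    using bounded_cbox[of a b] not_bounded_UNIV by metis
  have "\<exists>B>0. \<forall>a b. ball 0 B \<subseteq> cbox a b \<longrightarrow>
      (\<exists>z. ((\<lambda>x. f (x + c)) has_integral z) (cbox a b) \<and> norm (z - I) < e)" if "e > 0" for e
  proof -
    have "\<nexists>a b. UNIV = cbox a (b :: 'a)"
      using UNIV_not_cbox by simp
    from has_integral_altD[OF assms this that] obtain B where "B > 0"
      and "\<forall>a b. ball 0 B \<subseteq> cbox a b \<longrightarrow>
        (\<exists>z. ((\<lambda>x. if x \<in> UNIV then f x else 0) has_integral z) (cbox a b) \<and> norm (z - I) < e)" .
    then have B: "\<exists>z. (f has_integral z) (cbox a b) \<and> norm (z - I) < e" if "ball 0 B \<subseteq> cbox a b" for a b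
      using that by simp
    have "\<exists>z. ((\<lambda>x. f (x + c)) has_integral z) (cbox a b) \<and> norm (z - I) < e"
      if ab: "ball 0 (B + norm c) \<subseteq> cbox a b" for a b
    proof -
      have "ball 0 B \<subseteq> cbox (a + c) (b + c)"
      proof
        fix x :: 'a assume x: "x \<in> ball 0 B"
        then have "norm (x - c) < B + norm c"
          using norm_triangle_ineq4[of x c] by simp
        then have "x - c \<in> cbox a b"
          using ab by auto
        then show "x \<in> cbox (a + c) (b + c)"
          by (auto simp: mem_box algebra_simps)
      qed
      then obtain z where z: "(f has_integral z) (cbox (a + c) (b + c))" "norm (z - I) < e"
        using B by blast
      have "((\<lambda>x. f (x + c)) has_integral z) (cbox a b)"
        using has_integral_shift_cbox[OF z(1), of c] by simp
      with z(2) show ?thesis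
        by blast
    qed
    with \<open>B > 0\<close> show ?thesis
      by (intro exI[of _ "B + norm c"]) (auto simp: add_pos_nonneg)
  qed
  then show ?thesis
    using UNIV_not_cbox by (subst has_integral_alt) auto
qed

lemma has_integral_shift_atLeast:
  fixes f :: "real \<Rightarrow> 'b::banach"
  assumes "(f has_integral I) {h..}"
  shows "((\<lambda>t. f (t + h)) has_integral I) {0..}"
proof -
  have "((\<lambda>t. if t \<in> {h..} then f t else 0) has_integral I) UNIV"
    using assms by (subst has_integral_restrict_UNIV)
  then have "((\<lambda>t. if t + h \<in> {h..} then f (t + h) else 0) has_integral I) UNIV"
    by (rule has_integral_translation)
  then show ?thesis
    by (subst has_integral_restrict_UNIV[symmetric]) simp
qed

text \<open>The integrals of \<open>f\<close> over large compact intervals form a Cauchy net, because their differences are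
  dominated by the corresponding differences for \<open>g\<close>.\<close>

lemma integrable_on_atLeast_dominated:
  fixes f :: "real \<Rightarrow> 'b::banach"
  assumes f: "continuous_on {c..} f"
    and g: "g integrable_on {c..}"
    and le: "\<And>t. t \<ge> c \<Longrightarrow> norm (f t) \<le> g t"
  shows "f integrable_on {c..}"
proof -
  let ?f = "\<lambda>t. if t \<in> {c..} then f t else 0"
  let ?g = "\<lambda>t. if t \<in> {c..} then g t else 0"
  have int_f: "?f integrable_on cbox u v" for u v
  proof -
    have "{c..} \<inter> {u..v} = {max c u..v}" by auto
    moreover have "f integrable_on {max c u..v}"
      by (intro integrable_continuous_interval continuous_on_subset[OF f]) auto
    ultimately show ?thesis
      using integrable_restrict_Int[of "{c..}" f "{u..v}"] by simp
  qed
  note g_alt = integrable_alt[THEN iffD1, OF g]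
  have int_g: "?g integrable_on cbox u v" for u v
    using g_alt by blast
  have le': "norm (integral {v..v'} ?f) \<le> integral {v..v'} ?g" for v v'
    using int_f[of v v'] int_g[of v v'] le by (intro integral_norm_bound_integral) auto
  have "\<exists>B>0. \<forall>u v u' v'. ball 0 B \<subseteq> cbox u v \<and> ball 0 B \<subseteq> cbox u' v' \<longrightarrow>
      norm (integral (cbox u v) ?f - integral (cbox u' v') ?f) < e" if "e > 0" for e
  proof -
    obtain B where B: "B > 0" "\<And>u v u' v'. ball 0 B \<subseteq> cbox u v \<Longrightarrow> ball 0 B \<subseteq> cbox u' v' \<Longrightarrow>
        norm (integral (cbox u v) ?g - integral (cbox u' v') ?g) < e"
      using conjunct2[OF g_alt, rule_format, OF \<open>e > 0\<close>] by blast
    \<comment> \<open>The summand \<open>\<bar>c\<bar>\<close> ensures that the intervals considered contain \<open>c\<close>.\<close>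
    let ?B = "B + \<bar>c\<bar>"
    have tail: "norm (integral {u..v} ?f - integral {u'..v'} ?f) < e"
      if uv: "ball 0 ?B \<subseteq> {u..v}" "ball 0 ?B \<subseteq> {u'..v'}" and "v \<le> v'" for u v u' v'
    proof -
      have "{-?B<..<?B} \<subseteq> {u..v}" "{-?B<..<?B} \<subseteq> {u'..v'}"
        using uv by (simp_all add: ball_eq_greaterThanLessThan)
      then have bnd: "u \<le> - ?B" "?B \<le> v" "u' \<le> - ?B" "?B \<le> v'"
        using \<open>B > 0\<close> by (auto simp: greaterThanLessThan_subseteq_atLeastAtMost_iff)
      \<comment> \<open>Enlarging an interval only matters on its right end, as the integrand vanishes below \<open>c\<close>.\<close>
      have split: "integral {u'..v'} F - integral {u..v} F = integral {v..v'} F"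
        if F: "\<And>a b. F integrable_on cbox a b" "\<And>t. t < c \<Longrightarrow> F t = 0" for F :: "real \<Rightarrow> 'c::banach"
      proof -
        have 1: "integral {z..w} F = integral {c..w} F" if "z \<le> c" "c \<le> w" for z w
        proof -
          have "(F has_integral 0) {z..c}"
            by (rule has_integral_spike_finite[where S = "{c}" and f = "\<lambda>_. 0"]) (auto intro: F(2))
          then have "integral {z..c} F = 0"
            by (rule integral_unique)
          moreover have "integral {z..c} F + integral {c..w} F = integral {z..w} F"
            using that F(1)[of z w] by (intro Henstock_Kurzweil_Integration.integral_combine) simp_all
          ultimately show ?thesis
            by simp
        qed
        have "integral {c..v} F + integral {v..v'} F = integral {c..v'} F"
          using F(1)[of c v'] bnd \<open>v \<le> v'\<close> \<open>B > 0\<close>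
          by (intro Henstock_Kurzweil_Integration.integral_combine) simp_all
        then show ?thesis
          using 1[of u v] 1[of u' v'] bnd \<open>B > 0\<close> by (simp add: algebra_simps)
      qed
      have "norm (integral {u'..v'} ?f - integral {u..v} ?f) = norm (integral {v..v'} ?f)"
        by (subst split) (use int_f in auto)
      also have "\<dots> \<le> integral {v..v'} ?g"
        by (rule le')
      also have "\<dots> = integral {u'..v'} ?g - integral {u..v} ?g"
        by (subst split) (use int_g in auto)
      also have "\<dots> < e"
        using B(2)[of u' v' u v] uv \<open>B > 0\<close> by (force simp: abs_less_iff)
      finally show ?thesis
        by (simp add: norm_minus_commute)
    qed
    have "norm (integral {u..v} ?f - integral {u'..v'} ?f) < e"
      if "ball 0 ?B \<subseteq> {u..v}" "ball 0 ?B \<subseteq> {u'..v'}" for u v u' v'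
      using tail[of u v u' v'] tail[of u' v' u v] that by (cases "v \<le> v'") (auto simp: norm_minus_commute)
    then show ?thesis
      using \<open>B > 0\<close> by (intro exI[of _ ?B]) auto
  qed
  with int_f show ?thesis
    by (subst integrable_alt) meson
qed

text \<open>The level set of a value \<open>y \<noteq> 0\<close> has finite measure; the level set of \<open>0\<close> is usually of infinite
  measure, but contributes \<open>0\<close> in both integrals.\<close>

lemma has_integral_simple_bochner_integral:
  fixes s :: "'a::euclidean_space \<Rightarrow> 'b::real_normed_vector"
  assumes s: "Bochner_Integration.simple_bochner_integrable lborel s"
  shows "(s has_integral Bochner_Integration.simple_bochner_integral lborel s) UNIV"
proof -
  have fin: "finite (range s)" and meas: "s \<in> measurable lborel (count_space UNIV)"
    and supp: "emeasure lborel {t. s t \<noteq> 0} < \<infinity>"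
    using s by (auto simp: simple_function_eq_measurable less_top
      elim!: Bochner_Integration.simple_bochner_integrable.cases)
  have level: "{t. s t = y} \<in> sets borel" for y
    using measurable_sets[OF meas, of "{y}"] by (simp add: vimage_def)
  have supp_meas: "{t. s t \<noteq> 0} \<in> sets borel"
    using measurable_sets[OF meas, of "- {0}"] by (simp add: vimage_def Compl_eq)
  have 1: "((\<lambda>t. (if t \<in> {t. s t = y} then 1 else 0) *\<^sub>R y) has_integral
      measure lborel {t. s t = y} *\<^sub>R y) UNIV" for y
  proof (cases "y = 0")
    case False
    have "emeasure lborel {t. s t = y} \<le> emeasure lborel {t. s t \<noteq> 0}"
      using supp_meas False by (intro emeasure_mono) auto
    then have "emeasure lborel {t. s t = y} < \<infinity>"
      using supp by (rule le_less_trans)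
    then have "((\<lambda>t. if t \<in> {t. s t = y} then 1 else 0::real) has_integral measure lborel {t. s t = y}) UNIV"
      using has_integral_measure_lborel[OF level] by (subst has_integral_restrict_UNIV) auto
    from has_integral_linear[OF this bounded_linear_scaleR_left[of y]] show ?thesis
      by (simp add: o_def)
  qed simp
  have "((\<lambda>t. \<Sum>y\<in>range s. (if t \<in> {t. s t = y} then 1 else 0) *\<^sub>R y) has_integral
      (\<Sum>y\<in>range s. measure lborel {t. s t = y} *\<^sub>R y)) UNIV"
    by (intro has_integral_sum fin 1)
  moreover have "(\<Sum>y\<in>range s. (if t \<in> {t. s t = y} then 1 else 0) *\<^sub>R y) = s t" for t
  proof -
    have "(\<Sum>y\<in>range s. (if t \<in> {t. s t = y} then 1 else 0) *\<^sub>R y) = (\<Sum>y\<in>range s. if s t = y then y else 0)"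
      by (intro sum.cong) auto
    then show ?thesis
      using fin by simp
  qed
  ultimately show ?thesis
    by (simp add: Bochner_Integration.simple_bochner_integral_def)
qed

text \<open>By uniform continuity, it suffices to sample \<open>f\<close> at the multiples of a small \<open>1 / m\<close>.\<close>

lemma obtain_step_function_close:
  fixes f :: "real \<Rightarrow> 'b::real_normed_vector"
  assumes f: "continuous_on {0..N} f" and "e > 0"
  obtains s where "Bochner_Integration.simple_bochner_integrable lborel s"
    and "\<And>t. t \<in> {0..<N} \<Longrightarrow> norm (f t - s t) \<le> e"
    and "\<And>t. t \<notin> {0..<N} \<Longrightarrow> s t = 0"
proof -
  have "uniformly_continuous_on {0..N} f"
    by (intro compact_uniformly_continuous f compact_Icc)
  then obtain d where "d > 0" and d: "\<And>t u. t \<in> {0..N} \<Longrightarrow> u \<in> {0..N} \<Longrightarrow> dist u t < d \<Longrightarrow> dist (f u) (f t) < e"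
    using \<open>e > 0\<close> unfolding uniformly_continuous_on_def by metis
  obtain m :: nat where m: "m > 0" "inverse (real m) < d"
    using reals_Archimedean[OF \<open>d > 0\<close>] by (metis zero_less_Suc)
  define s where "s t = (if t \<in> {0..<N} then f (real_of_int \<lfloor>real m * t\<rfloor> / m) else 0)" for t
  have "range s \<subseteq> insert 0 ((\<lambda>i. f (real_of_int i / m)) ` {0..\<lfloor>real m * N\<rfloor>})"
  proof
    fix y assume "y \<in> range s"
    then obtain t where "y = s t" by blast
    moreover have "\<lfloor>real m * t\<rfloor> \<in> {0..\<lfloor>real m * N\<rfloor>}" if "t \<in> {0..<N}"
      using that m(1) by (auto intro!: floor_mono mult_left_mono)
    ultimately show "y \<in> insert 0 ((\<lambda>i. f (real_of_int i / m)) ` {0..\<lfloor>real m * N\<rfloor>})"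
      by (auto simp: s_def)
  qed
  then have fin: "finite (range s)"
    by (rule finite_subset) simp
  have "(\<lambda>t. real m * t) \<in> borel_measurable lborel"
    by simp
  then have "(\<lambda>t. \<lfloor>real m * t\<rfloor>) \<in> measurable lborel (count_space UNIV)"
    by (rule measurable_compose) (rule measurable_real_floor)
  then have "(\<lambda>t. f (real_of_int \<lfloor>real m * t\<rfloor> / m)) \<in> measurable lborel (count_space UNIV)"
    by (rule measurable_compose) simp
  then have "s \<in> measurable lborel (count_space UNIV)"
    unfolding s_def by (rule measurable_If_set) auto
  then have sf: "simple_function lborel s"
    using fin by (simp add: simple_function_eq_measurable)
  have supp: "emeasure lborel {t. s t \<noteq> 0} \<noteq> \<infinity>"
  proof -
    have "emeasure lborel {t. s t \<noteq> 0} \<le> emeasure lborel {0..N}"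
      by (intro emeasure_mono) (auto simp: s_def)
    also have "\<dots> < \<infinity>"
      by (simp add: emeasure_lborel_Icc_eq)
    finally show ?thesis by simp
  qed
  show thesis
  proof (rule that)
    show "Bochner_Integration.simple_bochner_integrable lborel s"
      using sf supp by (intro Bochner_Integration.simple_bochner_integrable.intros) auto
    show "s t = 0" if "t \<notin> {0..<N}" for t
      using that by (simp only: s_def if_False)
    show "norm (f t - s t) \<le> e" if t: "t \<in> {0..<N}" for t
    proof -
      let ?u = "real_of_int \<lfloor>real m * t\<rfloor> / m"
      have "t < (real_of_int \<lfloor>real m * t\<rfloor> + 1) / m"
        using m(1) by (simp add: pos_less_divide_eq mult.commute)
      then have "t - ?u < inverse m"
        by (simp add: add_divide_distrib inverse_eq_divide)
      moreover have "?u \<le> t" "0 \<le> ?u"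
        using m(1) t by (auto simp: pos_divide_le_eq mult.commute)
      ultimately have "?u \<in> {0..N}" "dist ?u t < d"
        using m(2) t by (auto simp: dist_real_def)
      with t have "dist (f t) (f ?u) < e"
        using t d[of t ?u] by (simp add: dist_commute)
      then show ?thesis
        using t by (simp add: s_def dist_norm)
    qed
  qed
qed

lemma has_integral_exp_decay:
  fixes c :: real
  assumes "c > 0"
  shows "((\<lambda>t. exp (- c * t)) has_integral 1 / c) {0..}"
  using has_integral_exp_minus_to_infinity[OF assms, of 0] by simp

lemma integrable_on_exp_decay:
  fixes f :: "real \<Rightarrow> 'b::banach"
  assumes f: "continuous_on {0..} f" and c: "c > 0"
    and le: "\<And>t. t \<ge> 0 \<Longrightarrow> norm (f t) \<le> K * exp (- c * t)"
  shows "f integrable_on {0..}"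
proof (rule integrable_on_atLeast_dominated[OF f])
  show "(\<lambda>t. K * exp (- c * t)) integrable_on {0..}"
    using has_integral_mult_right[OF has_integral_exp_decay[OF c], of K] by blast
qed (use le in auto)

lemma tendsto_0_le_ennreal:
  fixes u v :: "nat \<Rightarrow> ennreal"
  assumes "\<And>n. u n \<le> v n" and "v \<longlonglongrightarrow> 0"
  shows "u \<longlonglongrightarrow> 0"
  by (rule tendsto_sandwich[OF _ _ tendsto_const assms(2)]) (simp_all add: assms(1))

text \<open>The \<open>n\<close>-th step function \<open>s n\<close> samples \<open>f\<close> on $[0,n)$ so finely that the error is at most
  $e^{-cn/2}/(n+1)$ there. Beyond \<open>n\<close> the error is \<open>f\<close> itself, and half of its
  decay rate is spent on making it small. Both errors are thus
  below $\delta_n e^{-ct/2}$ with $\delta_n \to 0$, and this single bound controls the distance of the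
  integrals in either theory.\<close>

lemma has_set_bochner_integral_exp_decay:
  fixes f :: "real \<Rightarrow> 'b::banach"
  assumes f: "continuous_on {0..} f" and c: "c > 0"
    and le: "\<And>t. t \<ge> 0 \<Longrightarrow> norm (f t) \<le> K * exp (- c * t)"
  shows "has_set_bochner_integral lborel {0..} f (integral {0..} f)"
proof -
  define \<delta> where "\<delta> n = inverse (real (Suc n)) + \<bar>K\<bar> * exp (- (c / 2) * real n)" for n
  have \<delta>0: "\<delta> n \<ge> 0" for n
    by (simp add: \<delta>_def)
  have "(\<lambda>n. exp (- (c / 2) * real n)) \<longlonglongrightarrow> 0"
  proof -
    have "LIM n sequentially. - (c / 2) * real n :> at_bot"
      using c by (intro filterlim_tendsto_neg_mult_at_bot[OF tendsto_const _ filterlim_real_sequentially]) simp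
    then show ?thesis
      by (rule filterlim_compose[OF exp_at_bot])
  qed
  then have \<delta>_lim: "\<delta> \<longlonglongrightarrow> 0"
    unfolding \<delta>_def using tendsto_add[OF LIMSEQ_inverse_real_of_nat tendsto_mult[OF tendsto_const]] by fastforce
  have "\<exists>s. Bochner_Integration.simple_bochner_integrable lborel s \<and>
      (\<forall>t\<in>{0..<real n}. norm (f t - s t) \<le> inverse (Suc n) * exp (- (c / 2) * n)) \<and>
      (\<forall>t. t \<notin> {0..<real n} \<longrightarrow> s t = 0)" for n
  proof -
    have "continuous_on {0..real n} f"
      by (rule continuous_on_subset[OF f]) auto
    then show ?thesis
      by (rule obtain_step_function_close[where e = "inverse (Suc n) * exp (- (c / 2) * n)"]) auto
  qed
  then obtain s where s: "\<And>n. Bochner_Integration.simple_bochner_integrable lborel (s n)"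
    and s_close: "\<And>n t. t \<in> {0..<real n} \<Longrightarrow> norm (f t - s n t) \<le> inverse (Suc n) * exp (- (c / 2) * n)"
    and s_0: "\<And>n t. t \<notin> {0..<real n} \<Longrightarrow> s n t = 0"
    by metis
  have s_le: "norm (f t - s n t) \<le> \<delta> n * exp (- (c / 2) * t)" if "t \<ge> 0" for n t
  proof (cases "t < n")
    case True
    have "norm (f t - s n t) \<le> inverse (Suc n) * exp (- (c / 2) * n)"
      using s_close True that by simp
    also have "\<dots> \<le> \<delta> n * exp (- (c / 2) * t)"
      using True c by (intro mult_mono) (auto simp: \<delta>_def)
    finally show ?thesis .
  next
    case False
    have "norm (f t - s n t) \<le> K * exp (- c * t)"
      using s_0[of t n] False le[OF that] by simp
    also have "\<dots> \<le> \<bar>K\<bar> * (exp (- (c / 2) * t) * exp (- (c / 2) * t))"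
      by (simp add: mult_right_mono flip: exp_add)
    also have "\<dots> \<le> \<bar>K\<bar> * (exp (- (c / 2) * n) * exp (- (c / 2) * t))"
      using False c by (intro mult_left_mono mult_right_mono) auto
    also have "\<dots> \<le> \<delta> n * exp (- (c / 2) * t)"
      unfolding mult.assoc[symmetric] by (intro mult_right_mono) (auto simp: \<delta>_def)
    finally show ?thesis .
  qed
  have dom: "((\<lambda>t. \<delta> n * exp (- (c / 2) * t)) has_integral \<delta> n * (2 / c)) {0..}" for n
    using has_integral_mult_right[OF has_integral_exp_decay[of "c / 2"], of "\<delta> n"] c by simp
  have s_int: "(s n has_integral Bochner_Integration.simple_bochner_integral lborel (s n)) {0..}" for n
  proof -
    have "(\<lambda>t. if t \<in> {0..} then s n t else 0) = s n"
      using s_0[of _ n] by auto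
    then show ?thesis
      using has_integral_simple_bochner_integral[OF s] by (subst has_integral_restrict_UNIV[symmetric]) simp
  qed
  have f_int: "f integrable_on {0..}"
    using integrable_on_exp_decay[OF f c le] .
  show ?thesis
    unfolding has_set_bochner_integral_def
  proof (rule has_general_bochner_integral.intros)
    show "(\<lambda>t. indicator {0..} t *\<^sub>R f t) \<in> borel_measurable lborel"
      using borel_measurable_continuous_on_indicator[OF _ f] by simp
    show "Bochner_Integration.simple_bochner_integrable lborel (s n)" for n
      by (rule s)
    show "(\<lambda>n. Bochner_Integration.simple_bochner_integral lborel (s n)) \<longlonglongrightarrow> integral {0..} f"
    proof (rule LIM_zero_cancel, rule tendsto_norm_zero_cancel, rule tendsto_sandwich[OF _ _ tendsto_const])
      show "(\<lambda>n. \<delta> n * (2 / c)) \<longlonglongrightarrow> 0"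
        using tendsto_mult_left_zero[OF \<delta>_lim] .
      have "norm (integral {0..} (\<lambda>t. f t - s n t)) \<le> integral {0..} (\<lambda>t. \<delta> n * exp (- (c / 2) * t))" for n
        using f_int s_int dom s_le by (intro integral_norm_bound_integral integrable_diff) auto
      then have "norm (integral {0..} f -
          Bochner_Integration.simple_bochner_integral lborel (s n)) \<le> \<delta> n * (2 / c)" for n
        using integral_unique[OF dom] integral_unique[OF s_int]
          integral_diff[OF f_int has_integral_integrable[OF s_int]]
        by simp
      then show "\<forall>\<^sub>F n in sequentially.
          norm (Bochner_Integration.simple_bochner_integral lborel (s n) - integral {0..} f) \<le> \<delta> n * (2 / c)"
        by (simp add: norm_minus_commute)
    qed auto
    have "(\<integral>\<^sup>+t. ennreal (norm (indicator {0..} t *\<^sub>R f t - s n t)) \<partial>lborel) \<le> ennreal (\<delta> n * (2 / c))" for n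
    proof -
      have "norm (indicator {0..} t *\<^sub>R f t - s n t) \<le> indicator {0..} t * (\<delta> n * exp (- (c / 2) * t))" for t
        using s_le[of t n] s_0[of t n] by (cases "t \<ge> 0") auto
      then have "(\<integral>\<^sup>+t. ennreal (norm (indicator {0..} t *\<^sub>R f t - s n t)) \<partial>lborel)
          \<le> (\<integral>\<^sup>+t. ennreal (indicator {0..} t * (\<delta> n * exp (- (c / 2) * t))) \<partial>lborel)"
        by (intro nn_integral_mono ennreal_leI)
      also have "\<dots> = ennreal (\<delta> n * (2 / c))"
        by (rule nn_integral_has_integral_lebesgue[OF _ dom]) (simp add: \<delta>0)
      finally show ?thesis .
    qed
    moreover have "(\<lambda>n. ennreal (\<delta> n * (2 / c))) \<longlonglongrightarrow> 0"
      using tendsto_ennrealI[OF tendsto_mult_left_zero[OF \<delta>_lim, of "2 / c"]] by simp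
    ultimately show "(\<lambda>n. \<integral>\<^sup>+t. ennreal (norm (indicator {0..} t *\<^sub>R f t - s n t)) \<partial>lborel) \<longlonglongrightarrow> 0"
      by (rule tendsto_0_le_ennreal)
  qed
qed

lemma has_set_bochner_integral_cong:
  assumes "\<And>t. t \<in> S \<Longrightarrow> f t = g t"
  shows "has_set_bochner_integral N S f y \<longleftrightarrow> has_set_bochner_integral N S g y"
proof -
  have "(\<lambda>t. indicator S t *\<^sub>R f t) = (\<lambda>t. indicator S t *\<^sub>R g t)"
    using assms by (auto simp: fun_eq_iff split: split_indicator)
  then show ?thesis
    by (simp add: has_set_bochner_integral_def)
qed

section \<open>The sine of frequency $b$, normalised at the origin\<close>

text \<open>The solution of $s''=-b^2s$ with $s(0)=0$ and $s'(0)=1$. With this function the cases \<open>b = 0\<close> and \<open>b \<noteq> 0\<close>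
  obey the same differential equation and the same addition theorems.\<close>

definition normalized_sine :: "real \<Rightarrow> real \<Rightarrow> real" where
  "normalized_sine b t = (if b = 0 then t else sin (t * b) / b)"

lemma normalized_sine_eq_sinc: "normalized_sine b t = t * sinc (t * b)"
  by (auto simp: normalized_sine_def)

lemma normalized_sine_0 [simp]: "normalized_sine b 0 = 0"
  by (simp add: normalized_sine_def)

lemma normalized_sine_has_derivative:
  "(normalized_sine b has_real_derivative cos (t * b)) (at t within S)"
proof (cases "b = 0")
  case True
  then have "normalized_sine b = (\<lambda>t. t)"
    by (auto simp: normalized_sine_def)
  then show ?thesis
    using True by simp
next
  case False
  then have "normalized_sine b = (\<lambda>t. sin (t * b) / b)"
    by (auto simp: normalized_sine_def)
  then show ?thesis
    using False by (auto intro!: derivative_eq_intros)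
qed

lemma continuous_on_normalized_sine [continuous_intros]:
  "continuous_on S (normalized_sine b)"
  by (rule DERIV_continuous_on[OF normalized_sine_has_derivative])

lemma normalized_sine_diff:
  "normalized_sine b (t - h) = normalized_sine b t * cos (h * b) - cos (t * b) * normalized_sine b h"
  by (cases "b = 0") (simp_all add: normalized_sine_def left_diff_distrib sin_diff diff_divide_distrib)

lemma cos_diff_normalized_sine:
  "cos ((t - h) * b) = cos (t * b) * cos (h * b) + b\<^sup>2 * normalized_sine b t * normalized_sine b h"
  by (cases "b = 0") (simp_all add: normalized_sine_def left_diff_distrib cos_diff power2_eq_square)

lemma abs_normalized_sine_le: "\<bar>normalized_sine b t\<bar> \<le> \<bar>t\<bar>"
proof (cases "b = 0")
  case False
  have "\<bar>sin (t * b)\<bar> \<le> \<bar>t\<bar> * \<bar>b\<bar>"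
    using abs_sin_x_le_abs_x[of "t * b"] by (simp add: abs_mult)
  then show ?thesis
    using False by (simp add: normalized_sine_def pos_divide_le_eq)
qed (simp add: normalized_sine_def)

text \<open>The normalised sine is even in the frequency. This reconciles the frequency $b=|\mathrm{Im}(q)|$ with the
  signed coordinate of $\mathrm{Im}(q)$ on its slice.\<close>

lemma normalized_sine_abs_mult: "normalized_sine \<bar>b\<bar> t * b = sin (t * b)"
  by (auto simp: normalized_sine_def abs_if)

text \<open>The antiderivative is $-(t/c+1/c^2)e^{-ct}$.\<close>

lemma has_integral_linear_exp_decay:
  fixes c :: real
  assumes c: "c > 0"
  shows "((\<lambda>t. t * exp (- c * t)) has_integral 1 / c\<^sup>2) {0..}"
proof (rule has_integral_to_inf)
  define F where "F t = - (t / c + 1 / c\<^sup>2) * exp (- c * t)" for t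
  have F: "((\<lambda>t. t * exp (- c * t)) has_integral F y - F 0) {0..y}" if "y \<ge> 0" for y
  proof (rule fundamental_theorem_of_calculus[OF that])
    show "(F has_vector_derivative t * exp (- c * t)) (at t within {0..y})" for t
      unfolding F_def has_real_derivative_iff_has_vector_derivative[symmetric]
      using c by (auto intro!: derivative_eq_intros simp: field_simps power2_eq_square)
  qed
  show "(\<lambda>t. t * exp (- c * t)) integrable_on {0..y}" for y
    by (intro integrable_continuous_interval continuous_intros)
  have "(F \<longlongrightarrow> 0) at_top"
    unfolding F_def using c by real_asymp
  then have "((\<lambda>y. F y - F 0) \<longlongrightarrow> 1 / c\<^sup>2) at_top"
    using tendsto_diff[of F 0 at_top "\<lambda>_. F 0" "F 0"] by (simp add: F_def)
  moreover have "\<forall>\<^sub>F y in at_top. F y - F 0 = integral {0..y} (\<lambda>t. t * exp (- c * t))"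
    using eventually_ge_at_top[of 0] by eventually_elim (metis F integral_unique)
  ultimately show "((\<lambda>y. integral {0..y} (\<lambda>t. t * exp (- c * t))) \<longlongrightarrow> 1 / c\<^sup>2) at_top"
    by (rule Lim_transform_eventually)
qed simp

section \<open>Semigroups and weighted integrals of their orbits\<close>

locale exponentially_bounded_semigroup =
  fixes T :: "real \<Rightarrow> 'x::banach \<Rightarrow> 'x" and \<omega> M :: real
  assumes bounded_linear_T: "t \<ge> 0 \<Longrightarrow> bounded_linear (T t)"
    and continuous_orbit: "continuous_on {0..} (\<lambda>t. T t x)"
    and T_add: "s \<ge> 0 \<Longrightarrow> t \<ge> 0 \<Longrightarrow> T (s + t) x = T s (T t x)"
    and T_0: "T 0 x = x"
    and norm_T_le: "t \<ge> 0 \<Longrightarrow> norm (T t x) \<le> M * exp (\<omega> * t) * norm x"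
begin

text \<open>The graph of the generator, without a choice of values outside its domain.\<close>

definition generates :: "'x \<Rightarrow> 'x \<Rightarrow> bool" where
  "generates x y \<longleftrightarrow> ((\<lambda>h. (T h x - x) /\<^sub>R h) \<longlongrightarrow> y) (at_right 0)"

lemma generates_unique: "generates x y \<Longrightarrow> generates x z \<Longrightarrow> y = z"
  unfolding generates_def by (rule tendsto_unique) auto

text \<open>A bounded operator that commutes with the semigroup commutes with its difference quotients, hence
  maps the graph of the generator into itself.\<close>

lemma generates_linear_image:
  assumes L: "bounded_linear L" and comm: "\<And>t x. t \<ge> 0 \<Longrightarrow> L (T t x) = T t (L x)"
    and "generates x y"
  shows "generates (L x) (L y)"
proof -
  interpret L: bounded_linear L by fact
  have "((\<lambda>h. L ((T h x - x) /\<^sub>R h)) \<longlongrightarrow> L y) (at_right 0)"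
    using \<open>generates x y\<close> unfolding generates_def by (rule L.tendsto)
  moreover have "\<forall>\<^sub>F h in at_right 0. L ((T h x - x) /\<^sub>R h) = (T h (L x) - L x) /\<^sub>R h"
    by (intro eventually_at_rightI[of 0 1]) (auto simp: L.scaleR L.diff comm)
  ultimately show ?thesis
    unfolding generates_def by (rule Lim_transform_eventually)
qed

lemma generates_add:
  assumes "generates x x'" "generates y y'"
  shows "generates (x + y) (x' + y')"
proof -
  have "((\<lambda>h. (T h x - x) /\<^sub>R h + (T h y - y) /\<^sub>R h) \<longlongrightarrow> x' + y') (at_right 0)"
    using assms unfolding generates_def by (rule tendsto_add)
  moreover have "\<forall>\<^sub>F h in at_right 0. (T h x - x) /\<^sub>R h + (T h y - y) /\<^sub>R h
      = (T h (x + y) - (x + y)) /\<^sub>R h"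
    by (intro eventually_at_rightI[of 0 1])
       (auto simp: linear_add[OF bounded_linear.linear[OF bounded_linear_T]] algebra_simps)
  ultimately show ?thesis
    unfolding generates_def by (rule Lim_transform_eventually)
qed

lemma generates_scaleR: "generates x x' \<Longrightarrow> generates (c *\<^sub>R x) (c *\<^sub>R x')"
  by (rule generates_linear_image[OF bounded_linear_scaleR_right])
     (simp_all add: linear_cmul[OF bounded_linear.linear[OF bounded_linear_T]])

lemma generates_diff: "generates x x' \<Longrightarrow> generates y y' \<Longrightarrow> generates (x - y) (x' - y')"
  using generates_add[OF _ generates_scaleR[of y y' "-1"]] by simp

lemma generator_iff:
  assumes "is_generator T D A"
  shows "x \<in> D \<and> A x = y \<longleftrightarrow> generates x y"
  using assms generates_unique unfolding is_generator_def generates_def by blast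

text \<open>Weights that outweigh the exponential rate \<open>\<omega>\<close> of the semigroup. If \<open>\<omega>\<close> is negative, such a weight
  may itself grow exponentially.\<close>

definition weight :: "(real \<Rightarrow> real) \<Rightarrow> bool" where
  "weight \<phi> \<longleftrightarrow> continuous_on {0..} \<phi> \<and> (\<exists>K c. c > \<omega> \<and> (\<forall>t\<ge>0. \<bar>\<phi> t\<bar> \<le> K * exp (- c * t)))"

definition orbit_integral :: "(real \<Rightarrow> real) \<Rightarrow> 'x \<Rightarrow> 'x" where
  "orbit_integral \<phi> x = integral {0..} (\<lambda>t. \<phi> t *\<^sub>R T t x)"

lemma weighted_orbit_decay:
  assumes "weight \<phi>"
  obtains K c where "c > 0" "\<And>t. t \<ge> 0 \<Longrightarrow> norm (\<phi> t *\<^sub>R T t x) \<le> K * exp (- c * t)"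
proof -
  obtain K c where c: "c > \<omega>" and K: "\<And>t. t \<ge> 0 \<Longrightarrow> \<bar>\<phi> t\<bar> \<le> K * exp (- c * t)"
    using assms by (auto simp: weight_def)
  have "norm (\<phi> t *\<^sub>R T t x) \<le> (K * M * norm x) * exp (- (c - \<omega>) * t)" if "t \<ge> 0" for t
  proof -
    have "norm (\<phi> t *\<^sub>R T t x) \<le> (K * exp (- c * t)) * (M * exp (\<omega> * t) * norm x)"
      unfolding norm_scaleR using K[OF that] norm_T_le[OF that, of x]
      by (intro mult_mono) auto
    also have "\<dots> = (K * M * norm x) * exp (- (c - \<omega>) * t)"
      by (simp add: algebra_simps flip: exp_add)
    finally show ?thesis .
  qed
  with c show thesis
    by (intro that[of "c - \<omega>"]) auto
qed

lemma continuous_weighted_orbit: "weight \<phi> \<Longrightarrow> continuous_on {0..} (\<lambda>t. \<phi> t *\<^sub>R T t x)"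
  unfolding weight_def by (intro continuous_intros continuous_orbit) auto

lemma has_integral_orbit_integral:
  assumes "weight \<phi>"
  shows "((\<lambda>t. \<phi> t *\<^sub>R T t x) has_integral orbit_integral \<phi> x) {0..}"
  unfolding orbit_integral_def
  by (rule weighted_orbit_decay[OF assms], rule integrable_integral,
      rule integrable_on_exp_decay[OF continuous_weighted_orbit[OF assms]])

lemma has_set_bochner_integral_orbit_integral:
  assumes "weight \<phi>"
  shows "has_set_bochner_integral lborel {0..} (\<lambda>t. \<phi> t *\<^sub>R T t x) (orbit_integral \<phi> x)"
  unfolding orbit_integral_def
  by (rule weighted_orbit_decay[OF assms],
      rule has_set_bochner_integral_exp_decay[OF continuous_weighted_orbit[OF assms]])

lemma norm_orbit_integral_le:
  assumes "weight \<phi>" and le: "\<And>t. t \<ge> 0 \<Longrightarrow> \<bar>\<phi> t\<bar> \<le> \<psi> t"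
    and J: "((\<lambda>t. \<psi> t * exp (\<omega> * t)) has_integral J) {0..}"
  shows "norm (orbit_integral \<phi> x) \<le> M * J * norm x"
proof -
  have dom: "((\<lambda>t. (M * norm x) * (\<psi> t * exp (\<omega> * t))) has_integral (M * norm x) * J) {0..}"
    by (rule has_integral_mult_right[OF J])
  have "norm (\<phi> t *\<^sub>R T t x) \<le> (M * norm x) * (\<psi> t * exp (\<omega> * t))" if "t \<ge> 0" for t
  proof -
    have "norm (\<phi> t *\<^sub>R T t x) \<le> \<psi> t * (M * exp (\<omega> * t) * norm x)"
      unfolding norm_scaleR using le[OF that] norm_T_le[OF that, of x]
      by (intro mult_mono) auto
    then show ?thesis
      by (simp add: mult_ac)
  qed
  then have "norm (orbit_integral \<phi> x) \<le> integral {0..} (\<lambda>t. (M * norm x) * (\<psi> t * exp (\<omega> * t)))"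
    unfolding orbit_integral_def using has_integral_orbit_integral[OF assms(1)] dom
    by (intro integral_norm_bound_integral) (auto simp: has_integral_integrable_integral)
  also have "\<dots> = M * J * norm x"
    using integral_unique[OF dom] by (simp add: mult_ac)
  finally show ?thesis .
qed

lemma orbit_integral_linear_image:
  assumes "weight \<phi>" and L: "bounded_linear L" and comm: "\<And>t x. t \<ge> 0 \<Longrightarrow> L (T t x) = T t (L x)"
  shows "L (orbit_integral \<phi> x) = orbit_integral \<phi> (L x)"
proof -
  interpret L: bounded_linear L by fact
  have "(L \<circ> (\<lambda>t. \<phi> t *\<^sub>R T t x) has_integral L (orbit_integral \<phi> x)) {0..}"
    by (rule has_integral_linear[OF has_integral_orbit_integral[OF assms(1)] L])
  moreover have "(L \<circ> (\<lambda>t. \<phi> t *\<^sub>R T t x)) t = \<phi> t *\<^sub>R T t (L x)" if "t \<in> {0..}" for t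
    using that by (simp add: L.scaleR comm)
  ultimately have "((\<lambda>t. \<phi> t *\<^sub>R T t (L x)) has_integral L (orbit_integral \<phi> x)) {0..}"
    by (rule has_integral_eq[rotated])
  then show ?thesis
    using has_integral_orbit_integral[OF assms(1)] has_integral_unique by blast
qed

lemma bounded_linear_orbit_integral:
  assumes "weight \<phi>"
  shows "bounded_linear (orbit_integral \<phi>)"
proof -
  note int = has_integral_orbit_integral[OF assms]
  have lin: "T t (x + y) = T t x + T t y" "T t (r *\<^sub>R x) = r *\<^sub>R T t x" if "t \<ge> 0" for t r x y
    using bounded_linear.linear[OF bounded_linear_T[OF that]] by (auto simp: linear_add linear_cmul)
  obtain K c where c: "c > \<omega>" and K: "\<And>t. t \<ge> 0 \<Longrightarrow> \<bar>\<phi> t\<bar> \<le> K * exp (- c * t)"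
    using assms by (auto simp: weight_def)
  show ?thesis
  proof (rule bounded_linear_intro)
    show "orbit_integral \<phi> (r *\<^sub>R x) = r *\<^sub>R orbit_integral \<phi> x" for r x
      using orbit_integral_linear_image[OF assms bounded_linear_scaleR_right, of r x] lin by simp
    have "((\<lambda>t. \<phi> t *\<^sub>R T t (x + y)) has_integral orbit_integral \<phi> x + orbit_integral \<phi> y) {0..}" for x y
      by (rule has_integral_eq[OF _ has_integral_add[OF int int]]) (simp add: lin algebra_simps)
    then show "orbit_integral \<phi> (x + y) = orbit_integral \<phi> x + orbit_integral \<phi> y" for x y
      using int has_integral_unique by blast
    have "((\<lambda>t. K * exp (- (c - \<omega>) * t)) has_integral K * (1 / (c - \<omega>))) {0..}"
      using c by (intro has_integral_mult_right has_integral_exp_decay) simp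
    then have J: "((\<lambda>t. K * exp (- c * t) * exp (\<omega> * t)) has_integral K * (1 / (c - \<omega>))) {0..}"
      by (simp add: mult.assoc algebra_simps flip: exp_add)
    show "norm (orbit_integral \<phi> x) \<le> norm x * (M * (K * (1 / (c - \<omega>))))" for x
      using norm_orbit_integral_le[OF assms K J, of x] by (simp add: mult_ac)
  qed
qed

lemma shift_orbit_integral:
  assumes "weight \<phi>" "h \<ge> 0"
  shows "((\<lambda>t. \<phi> t *\<^sub>R T (t + h) x) has_integral T h (orbit_integral \<phi> x)) {0..}"
proof -
  interpret L: bounded_linear "T h" by (rule bounded_linear_T) fact
  have "(T h \<circ> (\<lambda>t. \<phi> t *\<^sub>R T t x) has_integral T h (orbit_integral \<phi> x)) {0..}"
    by (rule has_integral_linear[OF has_integral_orbit_integral[OF assms(1)] bounded_linear_T[OF assms(2)]])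
  moreover have "(T h \<circ> (\<lambda>t. \<phi> t *\<^sub>R T t x)) t = \<phi> t *\<^sub>R T (t + h) x" if "t \<in> {0..}" for t
    using that assms(2) by (simp add: L.scaleR add.commute[of t h] T_add)
  ultimately show ?thesis
    by (rule has_integral_eq[rotated])
qed

text \<open>The right-hand side is the integral of the orbit over $[h,\infty)$. It is written as a difference so
  that its derivative in \<open>h\<close> follows from the fundamental theorem of calculus on compact intervals.\<close>

lemma shifted_tail_orbit_integral:
  assumes "weight \<phi>" "h \<ge> 0"
  shows "((\<lambda>t. \<phi> (t + h) *\<^sub>R T (t + h) x) has_integral
      orbit_integral \<phi> x - integral {0..h} (\<lambda>t. \<phi> t *\<^sub>R T t x)) {0..}"
proof -
  let ?f = "\<lambda>t. \<phi> t *\<^sub>R T t x"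
  have f: "continuous_on {0..} ?f"
    by (rule continuous_weighted_orbit) fact
  have f0: "?f integrable_on {0..h}"
    by (intro integrable_continuous_interval continuous_on_subset[OF f]) auto
  obtain K c where K: "c > 0" "\<And>t. t \<ge> 0 \<Longrightarrow> norm (?f t) \<le> K * exp (- c * t)"
    using weighted_orbit_decay[OF assms(1)] by metis
  have "?f integrable_on {h..}"
  proof (rule integrable_on_atLeast_dominated)
    show "(\<lambda>t. K * exp (- c * t)) integrable_on {h..}"
      using has_integral_mult_right[OF has_integral_exp_minus_to_infinity[OF K(1)]] by blast
  qed (use K assms(2) in \<open>auto intro: continuous_on_subset[OF f]\<close>)
  then have fh: "(?f has_integral integral {h..} ?f) {h..}"
    by (rule integrable_integral)
  have "{0..h} \<union> {h..} = {0..}" "{0..h} \<inter> {h..} = {h}"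
    using assms(2) by auto
  then have "(?f has_integral integral {0..h} ?f + integral {h..} ?f) {0..}"
    using has_integral_Un[OF integrable_integral[OF f0] fh] by simp
  then have "integral {h..} ?f = orbit_integral \<phi> x - integral {0..h} ?f"
    using has_integral_orbit_integral[OF assms(1)] has_integral_unique by (metis add_diff_cancel_left')
  then show ?thesis
    using has_integral_shift_atLeast[OF fh] by simp
qed

lemma truncated_orbit_integral_has_derivative:
  assumes "weight \<phi>"
  shows "((\<lambda>h. orbit_integral \<phi> x - integral {0..h} (\<lambda>t. \<phi> t *\<^sub>R T t x))
      has_vector_derivative - (\<phi> 0 *\<^sub>R x)) (at 0 within {0..1})"
proof -
  have "continuous_on {0..1} (\<lambda>t. \<phi> t *\<^sub>R T t x)"
    by (rule continuous_on_subset[OF continuous_weighted_orbit[OF assms]]) auto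
  from integral_has_vector_derivative[OF this, of 0]
  show ?thesis
    by (auto intro!: derivative_eq_intros simp: T_0)
qed

text \<open>The generator is the one-sided derivative of the orbit at \<open>0\<close>; the interval \<open>{0..1}\<close> merely
  selects the side.\<close>

lemma generatesI:
  assumes F: "(F has_vector_derivative y) (at 0 within {0..1})"
    and eq: "\<And>h. h \<ge> 0 \<Longrightarrow> T h x = F h"
  shows "generates x y"
proof -
  have F_0: "F 0 = x"
    using eq[of 0] by (simp add: T_0)
  have "((\<lambda>h. (F h - F 0) /\<^sub>R h) \<longlongrightarrow> y) (at_right 0)"
  proof (rule LIM_zero_cancel)
    have "((\<lambda>h. (1 / norm (h - 0)) *\<^sub>R (F h - (F 0 + (h - 0) *\<^sub>R y))) \<longlongrightarrow> 0) (at_right 0)"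
      using F by (simp add: has_vector_derivative_def has_derivative_within at_within_Icc_at_right)
    moreover have "\<forall>\<^sub>F h in at_right 0. (1 / norm (h - 0)) *\<^sub>R (F h - (F 0 + (h - 0) *\<^sub>R y))
        = (F h - F 0) /\<^sub>R h - y"
      by (intro eventually_at_rightI[of 0 1]) (auto simp: algebra_simps inverse_eq_divide)
    ultimately show "((\<lambda>h. (F h - F 0) /\<^sub>R h - y) \<longlongrightarrow> 0) (at_right 0)"
      by (rule Lim_transform_eventually)
  qed
  moreover have "\<forall>\<^sub>F h in at_right 0. (F h - F 0) /\<^sub>R h = (T h x - x) /\<^sub>R h"
    using F_0 by (intro eventually_at_rightI[of 0 1]) (auto simp: eq)
  ultimately show ?thesis
    unfolding generates_def by (rule Lim_transform_eventually)
qed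

lemma weight_add:
  assumes "weight \<phi>" "weight \<psi>"
  shows "weight (\<lambda>t. \<phi> t + \<psi> t)"
proof -
  obtain K c where c: "c > \<omega>" and K: "\<And>t. t \<ge> 0 \<Longrightarrow> \<bar>\<phi> t\<bar> \<le> K * exp (- c * t)"
    using assms(1) by (auto simp: weight_def)
  obtain L d where d: "d > \<omega>" and L: "\<And>t. t \<ge> 0 \<Longrightarrow> \<bar>\<psi> t\<bar> \<le> L * exp (- d * t)"
    using assms(2) by (auto simp: weight_def)
  have le: "C * exp (- e * t) \<le> \<bar>C\<bar> * exp (- min c d * t)" if "t \<ge> 0" "min c d \<le> e" for C e t
    using that by (intro mult_mono) (auto simp: mult_right_mono)
  have "\<bar>\<phi> t + \<psi> t\<bar> \<le> (\<bar>K\<bar> + \<bar>L\<bar>) * exp (- min c d * t)" if "t \<ge> 0" for t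
    using K[OF that] L[OF that] le[OF that, of c K] le[OF that, of d L] abs_triangle_ineq[of "\<phi> t" "\<psi> t"]
    unfolding distrib_right by linarith
  moreover have "min c d > \<omega>"
    using c d by simp
  moreover have "continuous_on {0..} (\<lambda>t. \<phi> t + \<psi> t)"
    using assms by (auto simp: weight_def intro!: continuous_intros)
  ultimately show ?thesis
    unfolding weight_def by blast
qed

lemma weight_mult:
  assumes "weight \<phi>"
  shows "weight (\<lambda>t. r * \<phi> t)"
proof -
  obtain K c where c: "c > \<omega>" and K: "\<And>t. t \<ge> 0 \<Longrightarrow> \<bar>\<phi> t\<bar> \<le> K * exp (- c * t)"
    using assms by (auto simp: weight_def)
  have "\<bar>r * \<phi> t\<bar> \<le> (\<bar>r\<bar> * K) * exp (- c * t)" if "t \<ge> 0" for t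
    using mult_left_mono[OF K[OF that], of "\<bar>r\<bar>"] by (simp add: abs_mult mult.assoc)
  moreover have "continuous_on {0..} (\<lambda>t. r * \<phi> t)"
    using assms by (auto simp: weight_def intro!: continuous_intros)
  ultimately show ?thesis
    using c unfolding weight_def by blast
qed

end

section \<open>Inverting the quadratic polynomial in the generator\<close>

locale resolvent_weights = exponentially_bounded_semigroup T \<omega> M
  for T :: "real \<Rightarrow> 'x::banach \<Rightarrow> 'x" and \<omega> M :: real +
  fixes a b :: real
  assumes a_gt: "a > \<omega>"
begin

text \<open>With $a=\mathrm{Re}(q)$ and $b=|\mathrm{Im}(q)|$ this is the function $g_q$.\<close>

definition sine_weight :: "real \<Rightarrow> real" where
  "sine_weight t = exp (- a * t) * normalized_sine b t"

definition cosine_weight :: "real \<Rightarrow> real" where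
  "cosine_weight t = exp (- a * t) * cos (t * b)"

text \<open>The linear growth of the normalised sine costs an arbitrarily small part of the decay rate; half of
  the gap $a-\omega$ is given away here, so that the remaining rate lies midway between \<open>a\<close> and \<open>\<omega>\<close>.\<close>

lemma weight_sine: "weight sine_weight"
  unfolding weight_def
proof (intro conjI exI allI impI)
  show "continuous_on {0..} sine_weight"
    unfolding sine_weight_def by (intro continuous_intros)
  let ?d = "(a - \<omega>) / 2"
  show "a - ?d > \<omega>"
    using a_gt by (simp add: field_simps)
  fix t :: real assume t: "t \<ge> 0"
  have "t * ?d \<le> exp (?d * t)"
    using exp_ge_add_one_self[of "?d * t"] by (simp only: mult.commute[of t])
  moreover have "?d > 0"
    using a_gt by simp
  ultimately have "t \<le> 1 / ?d * exp (?d * t)"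
    by (simp only: pos_le_divide_eq[symmetric] times_divide_eq_left mult_1)
  moreover have "\<bar>sine_weight t\<bar> \<le> exp (- a * t) * t"
    using abs_normalized_sine_le[of b t] t by (simp add: sine_weight_def abs_mult)
  ultimately have "\<bar>sine_weight t\<bar> \<le> exp (- a * t) * (1 / ?d * exp (?d * t))"
    by (meson exp_ge_zero mult_left_mono order_trans)
  also have "\<dots> = 1 / ?d * exp (- (a - ?d) * t)"
    by (simp add: algebra_simps flip: exp_add)
  finally show "\<bar>sine_weight t\<bar> \<le> 1 / ?d * exp (- (a - ?d) * t)" .
qed

lemma weight_cosine: "weight cosine_weight"
  unfolding weight_def
proof (intro conjI exI allI impI)
  show "continuous_on {0..} cosine_weight"
    unfolding cosine_weight_def by (intro continuous_intros)
  show "a > \<omega>" by (rule a_gt)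
  show "\<bar>cosine_weight t\<bar> \<le> 1 * exp (- a * t)" for t
    by (simp add: cosine_weight_def abs_mult)
qed

text \<open>The addition theorem for \<open>t = (t + h) - h\<close>: translates of the weights stay in their span.\<close>

lemma sine_weight_addition:
  "sine_weight t = exp (a * h) *
    (cos (h * b) * sine_weight (t + h) - normalized_sine b h * cosine_weight (t + h))"
proof -
  have "sine_weight t = exp (- a * t) *
      (normalized_sine b (t + h) * cos (h * b) - cos ((t + h) * b) * normalized_sine b h)"
    using normalized_sine_diff[of b "t + h" h] by (simp add: sine_weight_def)
  also have "exp (- a * t) = exp (a * h) * exp (- a * (t + h))"
    by (simp add: algebra_simps flip: exp_add)
  finally show ?thesis
    unfolding sine_weight_def cosine_weight_def by algebra
qed

lemma cosine_weight_addition: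
  "cosine_weight t = exp (a * h) *
    (cos (h * b) * cosine_weight (t + h) + b\<^sup>2 * normalized_sine b h * sine_weight (t + h))"
proof -
  have "cosine_weight t = exp (- a * t) *
      (cos ((t + h) * b) * cos (h * b) + b\<^sup>2 * normalized_sine b (t + h) * normalized_sine b h)"
    using cos_diff_normalized_sine[of "t + h" h b] by (simp add: cosine_weight_def)
  also have "exp (- a * t) = exp (a * h) * exp (- a * (t + h))"
    by (simp add: algebra_simps flip: exp_add)
  finally show ?thesis
    unfolding sine_weight_def cosine_weight_def by algebra
qed

abbreviation "sine_tail x h \<equiv> orbit_integral sine_weight x - integral {0..h} (\<lambda>t. sine_weight t *\<^sub>R T t x)"
abbreviation "cosine_tail x h \<equiv> orbit_integral cosine_weight x - integral {0..h} (\<lambda>t. cosine_weight t *\<^sub>R T t x)"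

text \<open>\<open>T h\<close> advances the orbit by \<open>h\<close>; expressing the weight at \<open>t\<close> through the weights at \<open>t + h\<close>
  produces integrals of the same two kinds over $[h,\infty)$.\<close>

lemma T_sine_integral:
  assumes "h \<ge> 0"
  shows "T h (orbit_integral sine_weight x) =
    exp (a * h) *\<^sub>R (cos (h * b) *\<^sub>R sine_tail x h - normalized_sine b h *\<^sub>R cosine_tail x h)"
proof (rule has_integral_unique)
  show "((\<lambda>t. sine_weight t *\<^sub>R T (t + h) x) has_integral T h (orbit_integral sine_weight x)) {0..}"
    by (rule shift_orbit_integral[OF weight_sine assms])
  have "((\<lambda>t. exp (a * h) *\<^sub>R (cos (h * b) *\<^sub>R sine_weight (t + h) *\<^sub>R T (t + h) x
      - normalized_sine b h *\<^sub>R cosine_weight (t + h) *\<^sub>R T (t + h) x)) has_integral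
      exp (a * h) *\<^sub>R (cos (h * b) *\<^sub>R sine_tail x h - normalized_sine b h *\<^sub>R cosine_tail x h)) {0..}"
    by (intro has_integral_cmul has_integral_diff shifted_tail_orbit_integral weight_sine weight_cosine assms)
  then show "((\<lambda>t. sine_weight t *\<^sub>R T (t + h) x) has_integral
      exp (a * h) *\<^sub>R (cos (h * b) *\<^sub>R sine_tail x h - normalized_sine b h *\<^sub>R cosine_tail x h)) {0..}"
    by (subst sine_weight_addition[of _ h]) (simp add: scaleR_diff_left scaleR_diff_right right_diff_distrib)
qed

lemma T_cosine_integral:
  assumes "h \<ge> 0"
  shows "T h (orbit_integral cosine_weight x) =
    exp (a * h) *\<^sub>R (cos (h * b) *\<^sub>R cosine_tail x h + (b\<^sup>2 * normalized_sine b h) *\<^sub>R sine_tail x h)"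
proof (rule has_integral_unique)
  show "((\<lambda>t. cosine_weight t *\<^sub>R T (t + h) x) has_integral T h (orbit_integral cosine_weight x)) {0..}"
    by (rule shift_orbit_integral[OF weight_cosine assms])
  have "((\<lambda>t. exp (a * h) *\<^sub>R (cos (h * b) *\<^sub>R cosine_weight (t + h) *\<^sub>R T (t + h) x
      + (b\<^sup>2 * normalized_sine b h) *\<^sub>R sine_weight (t + h) *\<^sub>R T (t + h) x)) has_integral
      exp (a * h) *\<^sub>R (cos (h * b) *\<^sub>R cosine_tail x h + (b\<^sup>2 * normalized_sine b h) *\<^sub>R sine_tail x h)) {0..}"
    by (intro has_integral_cmul has_integral_add shifted_tail_orbit_integral weight_sine weight_cosine assms)
  then show "((\<lambda>t. cosine_weight t *\<^sub>R T (t + h) x) has_integral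
      exp (a * h) *\<^sub>R (cos (h * b) *\<^sub>R cosine_tail x h + (b\<^sup>2 * normalized_sine b h) *\<^sub>R sine_tail x h)) {0..}"
    by (subst cosine_weight_addition[of _ h]) (simp add: scaleR_add_left scaleR_add_right distrib_left mult_ac)
qed

text \<open>The derivative at \<open>0\<close> of the expressions in \<open>T_sine_integral\<close> (with \<open>c = - 1\<close>) and
  \<open>T_cosine_integral\<close> (with \<open>c = b\<^sup>2\<close>).\<close>

lemma scaled_rotation_has_derivative:
  assumes "(G has_vector_derivative G') (at 0 within S)" "(W has_vector_derivative W') (at 0 within S)"
  shows "((\<lambda>h. exp (a * h) *\<^sub>R (cos (h * b) *\<^sub>R G h + (c * normalized_sine b h) *\<^sub>R W h))
    has_vector_derivative a *\<^sub>R G 0 + G' + c *\<^sub>R W 0) (at 0 within S)"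
proof -
  have e: "((\<lambda>h. exp (a * h)) has_real_derivative a) (at 0 within S)"
    and c: "((\<lambda>h. cos (h * b)) has_real_derivative 0) (at 0 within S)"
    and n: "((\<lambda>h. c * normalized_sine b h) has_real_derivative c) (at 0 within S)"
    using normalized_sine_has_derivative[of b 0 S]
    by (auto intro!: derivative_eq_intros)
  have "((\<lambda>h. cos (h * b) *\<^sub>R G h + (c * normalized_sine b h) *\<^sub>R W h)
      has_vector_derivative G' + c *\<^sub>R W 0) (at 0 within S)"
    using has_vector_derivative_add[OF has_vector_derivative_scaleR[OF c assms(1)]
        has_vector_derivative_scaleR[OF n assms(2)]] by simp
  from has_vector_derivative_scaleR[OF e this] show ?thesis
    by (simp add: add_ac)
qed

lemma generates_sine_integral:
  "generates (orbit_integral sine_weight x)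
    (a *\<^sub>R orbit_integral sine_weight x - orbit_integral cosine_weight x)"
proof (rule generatesI[OF _ T_sine_integral])
  show "((\<lambda>h. exp (a * h) *\<^sub>R (cos (h * b) *\<^sub>R sine_tail x h - normalized_sine b h *\<^sub>R cosine_tail x h))
      has_vector_derivative a *\<^sub>R orbit_integral sine_weight x - orbit_integral cosine_weight x)
      (at 0 within {0..1})"
    using scaled_rotation_has_derivative[OF truncated_orbit_integral_has_derivative[OF weight_sine, of x]
        truncated_orbit_integral_has_derivative[OF weight_cosine, of x], of "- 1"]
    by (simp add: sine_weight_def)
qed

lemma generates_cosine_integral:
  "generates (orbit_integral cosine_weight x)
    (a *\<^sub>R orbit_integral cosine_weight x + b\<^sup>2 *\<^sub>R orbit_integral sine_weight x - x)"
proof (rule generatesI[OF _ T_cosine_integral])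
  show "((\<lambda>h. exp (a * h) *\<^sub>R (cos (h * b) *\<^sub>R cosine_tail x h + (b\<^sup>2 * normalized_sine b h) *\<^sub>R sine_tail x h))
      has_vector_derivative a *\<^sub>R orbit_integral cosine_weight x + b\<^sup>2 *\<^sub>R orbit_integral sine_weight x - x)
      (at 0 within {0..1})"
    using scaled_rotation_has_derivative[OF truncated_orbit_integral_has_derivative[OF weight_cosine, of x]
        truncated_orbit_integral_has_derivative[OF weight_sine, of x], of "b\<^sup>2"]
    by (simp add: cosine_weight_def algebra_simps)
qed

lemma norm_sine_integral_le: "norm (orbit_integral sine_weight x) \<le> M / (a - \<omega>)\<^sup>2 * norm x"
proof -
  have "((\<lambda>t. (t * exp (- a * t)) * exp (\<omega> * t)) has_integral 1 / (a - \<omega>)\<^sup>2) {0..}"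
    using has_integral_linear_exp_decay[of "a - \<omega>"] a_gt
    by (simp add: mult.assoc algebra_simps flip: exp_add)
  moreover have weight_le: "\<bar>sine_weight t\<bar> \<le> t * exp (- a * t)" if "t \<ge> 0" for t
    using abs_normalized_sine_le[of b t] that
    by (simp add: sine_weight_def abs_mult mult.commute mult_right_mono)
  ultimately have "norm (orbit_integral sine_weight x) \<le> M * (1 / (a - \<omega>)\<^sup>2) * norm x"
    by (intro norm_orbit_integral_le[OF weight_sine])
  then show ?thesis
    by simp
qed

lemma generator_sine_integral:
  assumes "is_generator T D A"
  shows "orbit_integral sine_weight x \<in> D"
    and "A (orbit_integral sine_weight x) = a *\<^sub>R orbit_integral sine_weight x - orbit_integral cosine_weight x"
  using generator_iff[OF assms] generates_sine_integral by blast+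

text \<open>Applying the generator twice to \<open>y\<close> and eliminating the cosine integral \<open>w\<close> between
  $Ay = ay - w$ and $Aw = aw + b^2y - x$ leaves only \<open>x\<close>.\<close>

lemma sine_integral_right_inverse:
  fixes x
  assumes "is_generator T D A"
  defines "y \<equiv> orbit_integral sine_weight x"
  shows "y \<in> domain_square D A" and "A (A y) - (2 * a) *\<^sub>R A y + (a\<^sup>2 + b\<^sup>2) *\<^sub>R y = x"
proof -
  define w where "w = orbit_integral cosine_weight x"
  have y: "generates y (a *\<^sub>R y - w)" and w: "generates w (a *\<^sub>R w + b\<^sup>2 *\<^sub>R y - x)"
    unfolding y_def w_def by (rule generates_sine_integral generates_cosine_integral)+
  have "generates (a *\<^sub>R y - w) (a *\<^sub>R (a *\<^sub>R y - w) - (a *\<^sub>R w + b\<^sup>2 *\<^sub>R y - x))"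
    by (intro generates_diff generates_scaleR y w)
  with y have D: "y \<in> D" "a *\<^sub>R y - w \<in> D" and A: "A y = a *\<^sub>R y - w"
    "A (a *\<^sub>R y - w) = a *\<^sub>R (a *\<^sub>R y - w) - (a *\<^sub>R w + b\<^sup>2 *\<^sub>R y - x)"
    using generator_iff[OF assms(1)] by blast+
  then show "y \<in> domain_square D A"
    by (simp add: domain_square_def)
  have double: "(2 * a) *\<^sub>R v = a *\<^sub>R v + a *\<^sub>R v" for v :: 'x
    by (simp flip: scaleR_add_left)
  show "A (A y) - (2 * a) *\<^sub>R A y + (a\<^sup>2 + b\<^sup>2) *\<^sub>R y = x"
    unfolding double by (simp add: A algebra_simps power2_eq_square)
qed

text \<open>The sine integral is a bounded operator commuting with the semigroup, so \<open>A\<close> can be moved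
  past it, which reduces the claim to the right inverse.\<close>

lemma sine_integral_left_inverse:
  assumes gen: "is_generator T D A" and x: "x \<in> domain_square D A"
  shows "orbit_integral sine_weight (A (A x) - (2 * a) *\<^sub>R A x + (a\<^sup>2 + b\<^sup>2) *\<^sub>R x) = x"
proof -
  let ?Q = "orbit_integral sine_weight"
  have Q: "bounded_linear ?Q"
    by (rule bounded_linear_orbit_integral[OF weight_sine])
  then interpret Q: bounded_linear ?Q .
  have comm: "?Q (T t x) = T t (?Q x)" if "t \<ge> 0" for t x
    by (rule orbit_integral_linear_image[OF weight_sine bounded_linear_T[OF that], symmetric])
       (use that in \<open>simp add: add.commute flip: T_add\<close>)
  have A_Q: "A (?Q z) = ?Q (A z)" if "z \<in> D" for z
    using generates_linear_image[OF Q comm] that generator_iff[OF gen] by blast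
  have "x \<in> D" "A x \<in> D"
    using x by (auto simp: domain_square_def)
  then show ?thesis
    using sine_integral_right_inverse(2)[OF gen, of x] by (simp add: A_Q Q.add Q.diff Q.scaleR)
qed

lemma cosine_minus_sine_integral:
  shows "weight (\<lambda>t. cosine_weight t - a * sine_weight t)"
    and "orbit_integral (\<lambda>t. cosine_weight t - a * sine_weight t) x
      = orbit_integral cosine_weight x - a *\<^sub>R orbit_integral sine_weight x"
proof -
  show w: "weight (\<lambda>t. cosine_weight t - a * sine_weight t)"
    using weight_add[OF weight_cosine weight_mult[OF weight_sine, of "- a"]] by simp
  have "((\<lambda>t. cosine_weight t *\<^sub>R T t x - a *\<^sub>R sine_weight t *\<^sub>R T t x) has_integral
      orbit_integral cosine_weight x - a *\<^sub>R orbit_integral sine_weight x) {0..}"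
    by (intro has_integral_diff has_integral_cmul has_integral_orbit_integral weight_sine weight_cosine)
  then have "((\<lambda>t. (cosine_weight t - a * sine_weight t) *\<^sub>R T t x) has_integral
      orbit_integral cosine_weight x - a *\<^sub>R orbit_integral sine_weight x) {0..}"
    by (simp add: scaleR_diff_left)
  with has_integral_orbit_integral[OF w] show
    "orbit_integral (\<lambda>t. cosine_weight t - a * sine_weight t) x
      = orbit_integral cosine_weight x - a *\<^sub>R orbit_integral sine_weight x"
    by (rule has_integral_unique)
qed

lemma sine_weight_has_derivative:
  "(sine_weight has_real_derivative cosine_weight t - a * sine_weight t) (at t)"
  unfolding sine_weight_def cosine_weight_def
  by (auto intro!: derivative_eq_intros normalized_sine_has_derivative simp: algebra_simps)

end

section \<open>The exponential on a slice\<close>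

lemma quadratic_cone_cases:
  fixes q :: "'a::real_star_algebra"
  assumes "q \<in> quadratic_cone"
  obtains j s where "j \<in> imag_sphere" "q = of_real (re q) + s *\<^sub>R j"
    "star q = of_real (re q) - s *\<^sub>R j" "Im_part q = s *\<^sub>R j"
proof -
  from assms obtain j r s where j: "j \<in> imag_sphere" and q: "q = of_real r + s *\<^sub>R j"
    by (auto simp: quadratic_cone_def slice_def)
  have star: "star q = of_real r - s *\<^sub>R j"
    using j star_real[of r] by (simp add: q star_add star_scaleR of_real_def imag_sphere_def)
  have "of_real (re q) = (of_real r :: 'a)"
    using of_real_re[OF assms] by (simp add: Re_part_def q[symmetric] star)
      (simp add: q of_real_def flip: scaleR_add_left)
  then have "re q = r"
    by simp
  moreover have "Im_part q = s *\<^sub>R j"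
    by (simp add: Im_part_def star) (simp add: q flip: scaleR_2)
  ultimately show thesis
    using that j q star by blast
qed

text \<open>$(r+sj)(r-sj)=r^2+s^2$, since $j^2=-1$.\<close>

lemma norm_slice:
  fixes j :: "'a::{real_star_algebra, real_normed_algebra_1}"
  assumes norm_cone: "\<And>p::'a. p \<in> quadratic_cone \<Longrightarrow> of_real ((norm p)\<^sup>2) = p * star p"
    and j: "j \<in> imag_sphere"
  shows "(norm (of_real r + s *\<^sub>R j))\<^sup>2 = r\<^sup>2 + s\<^sup>2"
proof -
  let ?p = "of_real r + s *\<^sub>R j"
  have "star ?p = of_real r - s *\<^sub>R j"
    using j star_real[of r] by (simp add: star_add star_scaleR of_real_def imag_sphere_def)
  moreover have "j * j = - 1"
    using j by (simp add: imag_sphere_def power2_eq_square)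
  ultimately have "?p * star ?p = of_real (r\<^sup>2 + s\<^sup>2)"
    by (simp only:) (simp add: algebra_simps of_real_def power2_eq_square)
  moreover have "?p \<in> quadratic_cone"
    using j by (auto simp: quadratic_cone_def slice_def)
  ultimately have "(of_real ((norm ?p)\<^sup>2) :: 'a) = of_real (r\<^sup>2 + s\<^sup>2)"
    using norm_cone by metis
  then show ?thesis
    by (rule of_real_eq_iff[THEN iffD1])
qed

text \<open>Euler's formula. The function $e^{-tj}(\cos t + j \sin t)$ has derivative zero, so it keeps its
  value \<open>1\<close> at \<open>t = 0\<close>.\<close>

lemma exp_scaleR_imaginary_unit:
  fixes j :: "'a::{real_normed_algebra_1, banach}"
  assumes j: "j * j = - 1"
  shows "exp (t *\<^sub>R j) = of_real (cos t) + sin t *\<^sub>R j"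
proof -
  define c where "c t = cos t *\<^sub>R 1 + sin t *\<^sub>R j" for t
  have "((\<lambda>t. exp (t *\<^sub>R - j) * c t) has_vector_derivative
      exp (t *\<^sub>R - j) * (- sin t *\<^sub>R 1 + cos t *\<^sub>R j) + exp (t *\<^sub>R - j) * - j * c t) (at t)" for t
    unfolding c_def
    by (intro has_vector_derivative_mult exp_scaleR_has_vector_derivative_right has_vector_derivative_add
        has_vector_derivative_scaleR[where g' = 0, simplified] DERIV_cos DERIV_sin has_vector_derivative_const)
  moreover have "- j * c t = - (- sin t *\<^sub>R 1 + cos t *\<^sub>R j)" for t
    by (simp add: c_def algebra_simps j)
  ultimately have "((\<lambda>t. exp (t *\<^sub>R - j) * c t) has_vector_derivative
      exp (t *\<^sub>R - j) * (- sin t *\<^sub>R 1 + cos t *\<^sub>R j)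
      + exp (t *\<^sub>R - j) * - (- sin t *\<^sub>R 1 + cos t *\<^sub>R j)) (at t)" for t
    by (simp only: mult.assoc)
  then have "((\<lambda>t. exp (t *\<^sub>R - j) * c t) has_vector_derivative 0) (at t)" for t
    by (simp only: mult_minus_right add.right_inverse)
  then obtain d where d: "\<And>t. exp (t *\<^sub>R - j) * c t = d"
    by (rule has_vector_derivative_zero_constant[OF convex_UNIV]) auto
  have "d = 1"
    using d[of 0] by (simp add: c_def)
  have "exp (t *\<^sub>R j) * exp (t *\<^sub>R - j) = 1"
    using exp_minus_inverse[of "t *\<^sub>R j"] by simp
  then have "c t = exp (t *\<^sub>R j) * (exp (t *\<^sub>R - j) * c t)"
    by (simp flip: mult.assoc)
  then show ?thesis
    unfolding d \<open>d = 1\<close> by (simp add: c_def of_real_def)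
qed

lemma exp_slice:
  fixes j :: "'a::{real_normed_algebra_1, banach}"
  assumes "j * j = - 1"
  shows "exp (- (t *\<^sub>R (of_real r + s *\<^sub>R j))) =
    of_real (exp (- r * t) * cos (t * s)) + (- (exp (- r * t) * sin (t * s))) *\<^sub>R j"
proof -
  have "- (t *\<^sub>R (of_real r + s *\<^sub>R j)) = of_real (- r * t) + (- (t * s)) *\<^sub>R j"
    by (simp add: of_real_def algebra_simps)
  also have "exp \<dots> = exp (of_real (- r * t)) * exp ((- (t * s)) *\<^sub>R j)"
    by (rule exp_add_commuting) (simp add: of_real_def)
  also have "exp (of_real (- r * t)) = (of_real (exp (- r * t)) :: 'a)"
    by (rule exp_of_real)
  also have "exp ((- (t * s)) *\<^sub>R j) = of_real (cos (t * s)) + (- sin (t * s)) *\<^sub>R j"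
    using exp_scaleR_imaginary_unit[OF assms, of "- (t * s)"] by simp
  finally show ?thesis
    by (simp add: of_real_def algebra_simps)
qed

section \<open>Two-sided modules\<close>

context banach_two_sided_module
begin

lemma bounded_linear_lmul: "bounded_linear (lmul p)"
proof (rule bounded_linear_intro)
  show "lmul p (r *\<^sub>R x) = r *\<^sub>R lmul p x" for r x
    by (simp add: lmul_lmul of_real_def flip: lmul_real)
  show "norm (lmul p x) \<le> norm x * norm p" for x
    using norm_lmul[of p x] by (simp add: mult.commute)
qed (rule lmul_add_right)

lemma bounded_linear_rmul: "bounded_linear (\<lambda>x. rmul x p)"
proof (rule bounded_linear_intro)
  show "rmul (r *\<^sub>R x) p = r *\<^sub>R rmul x p" for r x
    by (simp add: rmul_rmul of_real_def flip: rmul_real)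
  show "norm (rmul x p) \<le> norm x * norm p" for x
    using norm_rmul[of x p] by (simp add: mult.commute)
qed (rule rmul_add_left)

lemma lmul_scaleR: "lmul (r *\<^sub>R p) x = r *\<^sub>R lmul p x"
proof -
  have "r *\<^sub>R lmul p x = lmul (of_real r) (lmul p x)"
    by (rule lmul_real[symmetric])
  then show ?thesis
    by (simp add: lmul_lmul of_real_def)
qed

text \<open>Real homogeneity is the special case of right linearity for real scalars.\<close>

lemma bounded_right_linear_iff:
  "bounded_right_linear rmul B \<longleftrightarrow> bounded_linear B \<and> (\<forall>x q. B (rmul x q) = rmul (B x) q)"
proof
  assume B: "bounded_right_linear rmul B"
  then have add: "B (x + y) = B x + B y" and rmul: "B (rmul x q) = rmul (B x) q" for x y q
    by (auto simp: bounded_right_linear_def)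
  obtain K where K: "\<And>x. x \<noteq> 0 \<Longrightarrow> norm (B x) / norm x \<le> K"
    using B by (auto simp: bounded_right_linear_def bdd_above_def)
  have "B 0 = 0"
    using add[of 0 0] by simp
  then have "norm (B x) \<le> norm x * K" for x
    using K[of x] by (cases "x = 0") (auto simp: pos_divide_le_eq mult.commute)
  moreover have "B (r *\<^sub>R x) = r *\<^sub>R B x" for r x
    using rmul[of x "of_real r"] by (simp add: rmul_real)
  ultimately have "bounded_linear B"
    using add by (intro bounded_linear_intro)
  with rmul show "bounded_linear B \<and> (\<forall>x q. B (rmul x q) = rmul (B x) q)"
    by simp
next
  assume B: "bounded_linear B \<and> (\<forall>x q. B (rmul x q) = rmul (B x) q)"
  have "bdd_above ((\<lambda>x. norm (B x) / norm x) ` {x. x \<noteq> 0})"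
    using B le_onorm[of B] by (intro bdd_aboveI2[of _ _ "onorm B"]) auto
  with B show "bounded_right_linear rmul B"
    by (auto simp: bounded_right_linear_def linear_add bounded_linear.linear)
qed

end

section \<open>The integral representations\<close>

theorem theorem3p5:
  fixes lmul :: "'a::{real_star_algebra, real_normed_algebra_1, banach} \<Rightarrow> 'x::banach \<Rightarrow> 'x"
    and rmul :: "'x \<Rightarrow> 'a \<Rightarrow> 'x"
    and T :: "real \<Rightarrow> 'x \<Rightarrow> 'x"
    and D :: "'x set" and A :: "'x \<Rightarrow> 'x"
    and \<omega> M a b :: real
    and q :: 'a
    and g :: "real \<Rightarrow> real"
  assumes finite_dim: "\<exists>B::'a set. finite B \<and> span B = UNIV"
    and sphere_nonempty: "(imag_sphere :: 'a set) \<noteq> {}"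
    and norm_cone: "\<And>p::'a. p \<in> quadratic_cone \<Longrightarrow> of_real ((norm p)\<^sup>2) = p * star p"
    and module: "banach_two_sided_module lmul rmul"
    and semigroup: "right_linear_semigroup rmul T"
    and generator: "is_generator T D A"
    and M_finite: "bdd_above ((\<lambda>t. onorm (T t) * exp (- \<omega> * t)) ` {0..})"
    and M: "M = (SUP t\<in>{0..}. onorm (T t) * exp (- \<omega> * t))"
    and q: "q \<in> quadratic_cone"
    and a: "a = re q"
    and b: "b = norm (Im_part q)"
    and g: "g = (\<lambda>t. t * exp (- a * t) * sinc (t * b))"
    and Re_gt: "re q > \<omega>"
  shows "q \<in> spherical_resolvent_set rmul D A \<and>
    (\<forall>x.
      has_set_bochner_integral lborel {0..} (\<lambda>t. T t (g t *\<^sub>R x)) (quasi_resolvent D A q x) \<and>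
      has_set_bochner_integral lborel {0..}
        (\<lambda>t. T t ((t * exp (- t * a) * sinc (t * b)) *\<^sub>R x)) (quasi_resolvent D A q x) \<and>
      has_set_bochner_integral lborel {0..}
        (\<lambda>t. T t (deriv g t *\<^sub>R x)) (- A (quasi_resolvent D A q x)) \<and>
      has_set_bochner_integral lborel {0..}
        (\<lambda>t. T t ((exp (- t * a) * (cos (t * b) - a * t * sinc (t * b))) *\<^sub>R x))
        (- A (quasi_resolvent D A q x)) \<and>
      has_set_bochner_integral lborel {0..}
        (\<lambda>t. T t (lmul (exp (- (t *\<^sub>R q))) x)) (spherical_resolvent lmul D A q x)) \<and>
    onorm (quasi_resolvent D A q) \<le> M / (re q - \<omega>)\<^sup>2 \<and>
    bounded_right_linear rmul (spherical_resolvent lmul D A q) \<and>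
    onorm (spherical_resolvent lmul D A q) \<le> M / (re q - \<omega>)"
proof -
  interpret banach_two_sided_module lmul rmul by (rule module)
  have T_lin: "bounded_linear (T t)" and T_rmul: "T t (rmul x p) = rmul (T t x) p" if "t \<ge> 0" for t x p
    using semigroup that by (auto simp: right_linear_semigroup_def bounded_right_linear_iff)
  interpret resolvent_weights T \<omega> M a b
  proof (intro resolvent_weights.intro resolvent_weights_axioms.intro exponentially_bounded_semigroup.intro)
    show "bounded_linear (T t)" if "t \<ge> 0" for t
      using that by (rule T_lin)
    show "continuous_on {0..} (\<lambda>t. T t x)" for x
      using semigroup by (auto simp: right_linear_semigroup_def)
    show "T 0 x = x" for x
      using semigroup by (auto simp: right_linear_semigroup_def)
    show "T (s + t) x = T s (T t x)" if "s \<ge> 0" "t \<ge> 0" for s t x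
      using semigroup that by (cases "s = 0"; cases "t = 0") (auto simp: right_linear_semigroup_def)
    show "norm (T t x) \<le> M * exp (\<omega> * t) * norm x" if "t \<ge> 0" for t x
    proof -
      have "onorm (T t) * exp (- \<omega> * t) \<le> M"
        unfolding M using that by (intro cSUP_upper M_finite) auto
      then have "onorm (T t) \<le> M * exp (\<omega> * t)"
        by (simp add: exp_minus field_simps)
      then have "onorm (T t) * norm x \<le> M * exp (\<omega> * t) * norm x"
        by (rule mult_right_mono) simp
      then show ?thesis
        using onorm[OF T_lin[OF that], of x] by linarith
    qed
    show "a > \<omega>"
      using Re_gt a by simp
  qed
  let ?Q = "orbit_integral sine_weight" and ?W = "orbit_integral cosine_weight"
  obtain j s where j: "j \<in> imag_sphere" and q_eq: "q = of_real a + s *\<^sub>R j"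
    and star_q: "star q = of_real a - s *\<^sub>R j" and Im_q: "Im_part q = s *\<^sub>R j"
    using quadratic_cone_cases[OF q] a by metis
  have jj: "j * j = - 1"
    using j by (simp add: imag_sphere_def power2_eq_square)
  have b_eq: "b = \<bar>s\<bar>"
  proof -
    have "(norm (Im_part q))\<^sup>2 = s\<^sup>2"
      using norm_slice[OF norm_cone j, of 0 s] Im_q by simp
    then show ?thesis
      unfolding b by (simp add: power2_eq_iff_nonneg[of _ "\<bar>s\<bar>", simplified])
  qed
  have norm_q: "(norm q)\<^sup>2 = a\<^sup>2 + b\<^sup>2"
    using norm_slice[OF norm_cone j, of a s] by (simp add: b_eq q_eq)
  have Delta: "Delta_op A q x = A (A x) - (2 * a) *\<^sub>R A x + (a\<^sup>2 + b\<^sup>2) *\<^sub>R x" for x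
    by (simp add: Delta_op_def norm_q a)
  have right_inv: "?Q x \<in> domain_square D A" "Delta_op A q (?Q x) = x" for x
    using sine_integral_right_inverse[OF generator, of x] by (auto simp: Delta)
  have left_inv: "?Q (Delta_op A q x) = x" if "x \<in> domain_square D A" for x
    using sine_integral_left_inverse[OF generator that] by (simp add: Delta)
  have bij: "bij_betw (Delta_op A q) (domain_square D A) UNIV"
    by (rule bij_betw_byWitness[where f' = ?Q]) (use right_inv left_inv in auto)
  have quasi: "quasi_resolvent D A q = ?Q"
  proof
    fix x
    have "inv_into (domain_square D A) (Delta_op A q) (Delta_op A q (?Q x)) = ?Q x"
      using bij right_inv(1) by (intro inv_into_f_f) (auto simp: bij_betw_def)
    then show "quasi_resolvent D A q x = ?Q x"
      by (simp add: quasi_resolvent_def right_inv(2))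
  qed
  have A_Q: "A (?Q x) = a *\<^sub>R ?Q x - ?W x" for x
    by (rule generator_sine_integral[OF generator])
  have int_right_linear: "bounded_linear (orbit_integral \<phi>)"
      "orbit_integral \<phi> (rmul x p) = rmul (orbit_integral \<phi> x) p" if "weight \<phi>" for \<phi> x p
    using bounded_linear_orbit_integral[OF that]
      orbit_integral_linear_image[OF that bounded_linear_rmul, of p x] by (simp_all add: T_rmul)
  have Q_right_linear: "bounded_right_linear rmul ?Q"
    using int_right_linear[OF weight_sine] by (simp add: bounded_right_linear_iff)
  have resolvent: "q \<in> spherical_resolvent_set rmul D A"
    using q bij Q_right_linear by (simp add: spherical_resolvent_set_def quasi)

  have g_eq: "t * exp (- t * a) * sinc (t * b) = sine_weight t" "g t = sine_weight t" for t
    by (simp_all only: g sine_weight_def normalized_sine_eq_sinc) (auto simp: mult_ac)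
  then have g_sine: "g = sine_weight"
    by blast
  have g'_eq: "exp (- t * a) * (cos (t * b) - a * t * sinc (t * b)) = cosine_weight t - a * sine_weight t"
    "deriv g t = cosine_weight t - a * sine_weight t" for t
  proof -
    show "exp (- t * a) * (cos (t * b) - a * t * sinc (t * b)) = cosine_weight t - a * sine_weight t"
      by (simp only: cosine_weight_def sine_weight_def normalized_sine_eq_sinc) (auto simp: algebra_simps)
    show "deriv g t = cosine_weight t - a * sine_weight t"
      unfolding g_sine by (rule DERIV_imp_deriv[OF sine_weight_has_derivative])
  qed
  have int: "has_set_bochner_integral lborel {0..} (\<lambda>t. T t (\<phi> t *\<^sub>R x)) (orbit_integral \<phi> x)"
    if "weight \<phi>" for \<phi> x
    using has_set_bochner_integral_orbit_integral[OF that, of x]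
    by (subst has_set_bochner_integral_cong[where g = "\<lambda>t. \<phi> t *\<^sub>R T t x"])
       (simp_all add: linear_cmul[OF bounded_linear.linear[OF T_lin]])
  have minus_A_Q: "orbit_integral (\<lambda>t. cosine_weight t - a * sine_weight t) x = - A (?Q x)" for x
    by (simp add: cosine_minus_sine_integral(2) A_Q)

  let ?C = "spherical_resolvent lmul D A q"
  have C_eq: "?C x = ?Q (lmul (star q) x) + orbit_integral (\<lambda>t. cosine_weight t - a * sine_weight t) x" for x
    by (simp add: spherical_resolvent_def quasi minus_A_Q)
  \<comment> \<open>$e^{-tq} = g(t)q^c + g'(t)$, which reduces the third integral to the first two.\<close>
  have exp_eq: "exp (- (t *\<^sub>R q)) = sine_weight t *\<^sub>R star q + (cosine_weight t - a * sine_weight t) *\<^sub>R 1" for t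
  proof -
    have "sine_weight t * s = exp (- a * t) * sin (t * s)"
      unfolding sine_weight_def unfolding b_eq by (simp add: normalized_sine_abs_mult mult.assoc)
    moreover have "cosine_weight t = exp (- a * t) * cos (t * s)"
      unfolding cosine_weight_def unfolding b_eq by (simp add: abs_if)
    ultimately show ?thesis
      using exp_slice[OF jj, of t a s, folded q_eq] unfolding star_q
      by (simp add: of_real_def algebra_simps)
  qed
  \<comment> \<open>\<open>exp (- (t *\<^sub>R q))\<close> lies in the slice of \<open>j\<close>, where the norm is Euclidean.\<close>
  have norm_exp: "norm (exp (- (t *\<^sub>R q))) = exp (- a * t)" for t
  proof -
    have "(norm (exp (- (t *\<^sub>R q))))\<^sup>2 = (exp (- a * t) * cos (t * s))\<^sup>2 + (- (exp (- a * t) * sin (t * s)))\<^sup>2"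
      unfolding q_eq exp_slice[OF jj] by (rule norm_slice[OF norm_cone j])
    also have "\<dots> = (exp (- a * t))\<^sup>2 * ((cos (t * s))\<^sup>2 + (sin (t * s))\<^sup>2)"
      by (simp only: power_mult_distrib power2_minus distrib_left)
    finally show ?thesis
      by simp
  qed
  have M_nonneg: "0 \<le> M"
  proof -
    have "0 \<le> onorm (T 0) * exp (- \<omega> * 0)"
      using onorm_pos_le[OF T_lin[of 0]] by simp
    also have "\<dots> \<le> M"
      unfolding M by (intro cSUP_upper M_finite) auto
    finally show ?thesis .
  qed
  let ?f = "\<lambda>x t. T t (lmul (exp (- (t *\<^sub>R q))) x)"
  have f_eq: "?f x t = sine_weight t *\<^sub>R T t (lmul (star q) x) + (cosine_weight t - a * sine_weight t) *\<^sub>R T t x"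
    if "t \<ge> 0" for x t
    using linear_add[OF bounded_linear.linear[OF T_lin[OF that]]]
      linear_cmul[OF bounded_linear.linear[OF T_lin[OF that]]]
    unfolding exp_eq lmul_add_left lmul_scaleR lmul_one by simp
  have f_cont: "continuous_on {0..} (?f x)" for x
    by (subst continuous_on_cong[OF refl f_eq])
       (auto intro!: continuous_on_add continuous_weighted_orbit weight_sine cosine_minus_sine_integral(1))
  have f_le: "norm (?f x t) \<le> (M * norm x) * exp (- (a - \<omega>) * t)" if "t \<ge> 0" for x t
  proof -
    have "norm (?f x t) \<le> M * exp (\<omega> * t) * norm (lmul (exp (- (t *\<^sub>R q))) x)"
      by (rule norm_T_le[OF that])
    also have "\<dots> \<le> M * exp (\<omega> * t) * (exp (- a * t) * norm x)"
    proof (rule mult_left_mono)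
      show "norm (lmul (exp (- (t *\<^sub>R q))) x) \<le> exp (- a * t) * norm x"
        using norm_lmul[of "exp (- (t *\<^sub>R q))" x] by (simp only: norm_exp)
      show "0 \<le> M * exp (\<omega> * t)"
        using M_nonneg by simp
    qed
    also have "\<dots> = (M * norm x) * exp (- (a - \<omega>) * t)"
      by (simp add: algebra_simps flip: exp_add)
    finally show ?thesis .
  qed
  have decay: "a - \<omega> > 0"
    using a_gt by simp
  have "(?f x has_integral ?C x) {0..}" for x
    unfolding C_eq
    by (rule has_integral_eq[OF _ has_integral_add[OF has_integral_orbit_integral[OF weight_sine]
          has_integral_orbit_integral[OF cosine_minus_sine_integral(1)]]]) (simp only: f_eq atLeast_iff)
  then have f_int: "integral {0..} (?f x) = ?C x" "?f x integrable_on {0..}" for x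
    by (auto intro: integral_unique)
  have C_int: "has_set_bochner_integral lborel {0..} (?f x) (?C x)" for x
    using has_set_bochner_integral_exp_decay[OF f_cont decay f_le] by (simp only: f_int(1))
  have norm_C: "norm (?C x) \<le> M / (a - \<omega>) * norm x" for x
  proof -
    have dom: "((\<lambda>t. (M * norm x) * exp (- (a - \<omega>) * t)) has_integral (M * norm x) * (1 / (a - \<omega>))) {0..}"
      by (rule has_integral_mult_right[OF has_integral_exp_decay[OF decay]])
    have "norm (integral {0..} (?f x)) \<le> integral {0..} (\<lambda>t. (M * norm x) * exp (- (a - \<omega>) * t))"
      using f_int(2) dom f_le by (intro integral_norm_bound_integral) auto
    then show ?thesis
      using integral_unique[OF dom] by (simp add: f_int(1))
  qed
  have C_right_linear: "bounded_right_linear rmul ?C"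
    unfolding bounded_right_linear_iff
  proof (intro conjI allI)
    show "bounded_linear ?C"
      unfolding C_eq[abs_def]
      by (intro bounded_linear_add bounded_linear_compose[OF _ bounded_linear_lmul] int_right_linear(1)
          weight_sine cosine_minus_sine_integral(1))
    show "?C (rmul x p) = rmul (?C x) p" for x p
      unfolding C_eq lmul_rmul int_right_linear(2)[OF weight_sine]
        int_right_linear(2)[OF cosine_minus_sine_integral(1)] rmul_add_left ..
  qed
  have norm_Q: "onorm ?Q \<le> M / (a - \<omega>)\<^sup>2"
    by (intro onorm_bound norm_sine_integral_le divide_nonneg_nonneg M_nonneg) simp
  have onorm_C: "onorm ?C \<le> M / (a - \<omega>)"
    by (intro onorm_bound norm_C divide_nonneg_pos M_nonneg decay)
  show ?thesis
    unfolding quasi g_eq g'_eq minus_A_Q[symmetric] a[symmetric]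
    using resolvent norm_Q onorm_C C_right_linear C_int int[OF weight_sine] int[OF cosine_minus_sine_integral(1)]
    by blast
qed

end
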